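(* For any $d\ge1$ there exists a constant $C_d$ such that for every $M\in S_d^+$, $$\int_{\mathcal O_d}\lambda_d(R^{T}MR)\,dR\le C_d(\det M)^{\frac1{2d}},$$ where $\mathcal O_d$ is the group of $d\times d$ orthogonal matrices equipped with its Haar probability measure.
   Context: $S_d^+$ is the set of $d\times d$ symmetric positive definite matrices; $\|u\|_M:=\sqrt{u^TMu}$. The successive Minkowski minima of $M\in S_d^+$ are, for $1\le i\le d$, $\lambda_i(M):=\min\{\|u_i\|_M;\ (u_1,\dots,u_i)\in(\mathbb Z^d)^i \text{ linearly independent},\ \|u_1\|_M\le\dots\le\|u_i\|_M\}$. *)

theory Defs
  imports "HOL-Analysis.Analysis"
begin

definition sym_pos_def :: "real^'n^'n \<Rightarrow> bool" where
  "sym_pos_def M \<longleftrightarrow> transpose M = M \<and> (\<forall>x::real^'n. x \<noteq> 0 \<longrightarrow> x \<bullet> (M *v x) > 0)"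

definition normM :: "real^'n^'n \<Rightarrow> real^'n \<Rightarrow> real" where
  "normM M u = sqrt (u \<bullet> (M *v u))"

definition int_vec :: "real^'n \<Rightarrow> bool" where
  "int_vec u \<longleftrightarrow> (\<forall>k. u $ k \<in> \<int>)"

definition succ_min :: "nat \<Rightarrow> real^'n^'n \<Rightarrow> real" where
  "succ_min i M = Inf {normM M (u i) | u :: nat \<Rightarrow> real^'n.
      (\<forall>j\<in>{1..i}. int_vec (u j)) \<and> inj_on u {1..i} \<and> independent (u ` {1..i}) \<and>
      (\<forall>j\<in>{1..<i}. normM M (u j) \<le> normM M (u (Suc j)))}"

text \<open>Haar probability measure on the orthogonal group O_d, realised as a Borel
  probability measure on the space of d x d real matrices concentrated on O_d and
  invariant under left multiplication by orthogonal matrices (unique by uniqueness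
  of Haar measure on compact groups).\<close>
definition haar_orthogonal :: "(real^'n^'n) measure \<Rightarrow> bool" where
  "haar_orthogonal \<mu> \<longleftrightarrow> emeasure \<mu> (space \<mu>) = 1 \<and> sets \<mu> = sets borel \<and>
     emeasure \<mu> {R. orthogonal_matrix R} = 1 \<and>
     (\<forall>Q. orthogonal_matrix Q \<longrightarrow> distr \<mu> \<mu> (\<lambda>R. Q ** R) = \<mu>)"

end

theory Submission
  imports Defs "HOL-Probability.Probability_Measure"
begin

text \<open>
  Write \<open>M = S\<^sup>T S\<close> and \<open>T = S\<^sup>-\<^sup>T\<close>, so that the norm attached to
  \<open>R\<^sup>T M R\<close> is \<open>u \<mapsto> |S R u|\<close> and the dual lattice is \<open>T R \<int>\<^sup>d\<close>. A transference argument
  bounds \<open>\<lambda>\<^sub>d\<close> by a constant times the inverse of the length of the shortest nonzero dual vector,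
  hence, for any \<open>a > 0\<close>, by \<open>1/a + \<Sum>\<^sub>w f(T R w)\<close> where \<open>f z\<close> dominates \<open>1/|z|\<close> for
  \<open>|z| < a\<close> and vanishes for \<open>|z| \<ge> a\<close>. Averaged over \<open>R\<close>, the summand becomes a radially
  decreasing function of \<open>w\<close>, whose sum over nonzero integer vectors is at most a constant times its
  integral. By Fubini that integral is \<open>|det T|\<^sup>-\<^sup>1 \<integral> f\<close>, which is finite for \<open>d \<ge> 2\<close> because
  \<open>1/|z|\<close> is then locally integrable; the choice \<open>a\<^sup>d = |det T|\<close> gives the bound. For
  \<open>d = 1\<close> the claim is immediate.
\<close>

section \<open>Transference\<close>

lemma of_int_scaleR_in_subgroup:
  fixes w :: "'a::real_vector"
  assumes "0 \<in> G" and diff: "\<And>x y. x \<in> G \<Longrightarrow> y \<in> G \<Longrightarrow> x - y \<in> G" and "w \<in> G"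
  shows "of_int z *\<^sub>R w \<in> G"
proof -
  have neg: "- x \<in> G" if "x \<in> G" for x
    using diff[OF \<open>0 \<in> G\<close> that] by simp
  have nat: "of_nat n *\<^sub>R w \<in> G" for n :: nat
  proof (induction n)
    case (Suc n)
    have "of_nat n *\<^sub>R w - (- w) \<in> G"
      using Suc neg \<open>w \<in> G\<close> by (intro diff)
    then show ?case
      by (simp add: algebra_simps)
  qed (simp add: \<open>0 \<in> G\<close>)
  show ?thesis
    using nat[of "nat z"] neg[OF nat[of "nat (- z)"]] by (cases "z \<ge> 0") auto
qed

text \<open>
  Covering radius bound for the dual of a discrete group \<open>K\<close>, phrased without mentioning the dual:
  every character \<open>exp (2\<pi>i \<phi>)\<close> of \<open>K\<close> is induced by a short vector. In the induction, an almost
  shortest \<open>w \<in> K\<close> is handled by a multiple of \<open>w\<close>, after which the character factors through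
  the projection of \<open>K\<close> orthogonal to \<open>w\<close>; this projection has separation at least
  \<open>1 / sqrt 2\<close> times that of \<open>K\<close>, as lifts can be chosen with \<open>w\<close>-coefficient at most \<open>1/2\<close>.
\<close>

lemma bounded_coset_representative:
  fixes V :: "'a::euclidean_space set"
  assumes "subspace V" and "K \<subseteq> V" and "0 \<in> K"
    and "\<And>x y. x \<in> K \<Longrightarrow> y \<in> K \<Longrightarrow> x - y \<in> K"
    and "m > 0" and "\<And>k. k \<in> K \<Longrightarrow> k \<noteq> 0 \<Longrightarrow> m \<le> norm k"
    and "\<And>x y. x \<in> K \<Longrightarrow> y \<in> K \<Longrightarrow> \<phi> (x - y) - \<phi> x + \<phi> y \<in> \<int>"
    and "dim V = n"
  shows "\<exists>y\<in>V. norm y \<le> 2 ^ n / m \<and> (\<forall>k\<in>K. y \<bullet> k - \<phi> k \<in> \<int>)"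
  using assms
proof (induction n arbitrary: V K m \<phi>)
  \<comment> \<open>If \<open>K\<close> is at most \<open>{0}\<close>, then \<open>\<phi> 0\<close>
    is an integer by additivity modulo integers, so the zero vector works. This serves the base case
    and the degenerate inductive case.\<close>
  have trivial: "\<exists>y\<in>V. norm y \<le> 2 ^ n / m \<and> (\<forall>k\<in>K. y \<bullet> k - \<phi> k \<in> \<int>)"
    if "subspace V" "K \<subseteq> {0}" "m > 0"
      and \<phi>: "\<And>x y. x \<in> K \<Longrightarrow> y \<in> K \<Longrightarrow> \<phi> (x - y) - \<phi> x + \<phi> y \<in> \<int>"
    for V K :: "'a set" and m :: real and \<phi> and n :: nat
  proof (intro bexI[of _ 0] conjI ballI)
    fix k assume "k \<in> K"
    with that(2) \<phi>[of k k] show "0 \<bullet> k - \<phi> k \<in> \<int>" by auto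
  qed (use that in \<open>auto simp: subspace_0\<close>)
  {
    case 0
    then have "K \<subseteq> {0}"
      by (simp add: dim_eq_0)
    with 0 show ?case
      by (intro trivial) auto
  next
    case (Suc n)
    note V = \<open>subspace V\<close> and KV = \<open>K \<subseteq> V\<close> and K0 = \<open>0 \<in> K\<close>
      and Kdiff = Suc.prems(4) and sep = Suc.prems(6) and \<phi> = Suc.prems(7)
    show ?case
    proof (cases "K \<subseteq> {0}")
      case True
      with Suc.prems show ?thesis
        by (intro trivial) auto
    next
      case False
      define m' where "m' = Inf (norm ` (K - {0}))"
      have ne: "norm ` (K - {0}) \<noteq> {}"
        using False by auto
      have "m \<le> m'"
        unfolding m'_def using ne sep by (intro cInf_greatest) auto
      then have "m' > 0"
        using \<open>m > 0\<close> by linarith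
      have sep': "m' \<le> norm k" if "k \<in> K" "k \<noteq> 0" for k
        unfolding m'_def using that by (intro cInf_lower bdd_belowI[of _ 0]) auto
      \<comment> \<open>The infimum is not shown to be attained; a factor \<open>sqrt 2\<close> is
        tolerable because a \<open>w\<close>-coefficient of size at most \<open>1/2\<close> then
        contributes at most \<open>m'^2 / 2\<close> to a squared norm.\<close>
      have "Inf (norm ` (K - {0})) < sqrt 2 * m'"
        using \<open>m' > 0\<close> unfolding m'_def[symmetric] by simp
      then obtain w where w: "w \<in> K" "w \<noteq> 0" "norm w < sqrt 2 * m'"
        using cInf_lessD[OF ne] by auto
      have w2: "(norm w)\<^sup>2 \<le> 2 * m'\<^sup>2"
        using power_mono[of "norm w" "sqrt 2 * m'" 2] w(3) by (simp add: power_mult_distrib)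
      have ww: "w \<bullet> w > 0"
        using w by simp
      \<comment> \<open>Signed offset of \<open>\<phi> w\<close> from its nearest integer. Since
        \<open>y0 \<bullet> w = t\<close>, subtracting \<open>y0\<close> leaves a character
        \<open>\<psi>\<close> that is integral at \<open>w\<close>, and \<open>|t|\<close> at most
        \<open>1/2\<close> keeps \<open>y0\<close> short.\<close>
      define t where "t = \<phi> w - of_int (round (\<phi> w))"
      have t: "\<bar>t\<bar> \<le> 1/2"
        unfolding t_def using of_int_round_abs_le[of "\<phi> w"] by (simp add: abs_minus_commute)
      define y0 where "y0 = (t / (w \<bullet> w)) *\<^sub>R w"
      define \<psi> where "\<psi> k = \<phi> k - y0 \<bullet> k" for k
      have \<psi>: "\<psi> (x - y) - \<psi> x + \<psi> y \<in> \<int>" if "x \<in> K" "y \<in> K" for x y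
        using \<phi>[OF that] by (simp add: \<psi>_def algebra_simps inner_diff_right)
      have \<psi>w: "\<psi> w \<in> \<int>"
        using ww by (simp add: \<psi>_def y0_def t_def)
      have \<psi>0: "\<psi> 0 \<in> \<int>"
        using \<psi>[OF K0 K0] by simp
      define P where "P k = k - ((w \<bullet> k) / (w \<bullet> w)) *\<^sub>R w" for k
      have Pdiff: "P (x - y) = P x - P y" for x y
        by (simp add: P_def inner_diff_right diff_divide_distrib algebra_simps)
      have wP: "w \<bullet> P k = 0" for k
        using ww by (simp add: P_def inner_diff_right)
      \<comment> \<open>Reduction modulo \<open>w\<close>: \<open>r k\<close> stays in
        \<open>K\<close>, has the same projection as \<open>k\<close>, and its
        \<open>w\<close>-coefficient is at most \<open>1/2\<close> in absolute value.\<close>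
      define r where "r k = k - of_int (round ((w \<bullet> k) / (w \<bullet> w))) *\<^sub>R w" for k
      have rK: "r k \<in> K" if "k \<in> K" for k
        unfolding r_def using of_int_scaleR_in_subgroup[OF K0 Kdiff \<open>w \<in> K\<close>] that Kdiff by blast
      have norm_r: "(norm (r k))\<^sup>2 \<le> (norm (P k))\<^sup>2 + m'\<^sup>2 / 2" for k
      proof -
        define c where "c = (w \<bullet> k) / (w \<bullet> w) - of_int (round ((w \<bullet> k) / (w \<bullet> w)))"
        have "\<bar>c\<bar> \<le> 1/2"
          unfolding c_def using of_int_round_abs_le[of "(w \<bullet> k) / (w \<bullet> w)"]
          by (simp add: abs_minus_commute)
        then have "c\<^sup>2 \<le> 1/4"
          using power_mono[of "\<bar>c\<bar>" "1/2" 2] by (simp add: power2_eq_square)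
        have "r k = P k + c *\<^sub>R w"
          by (simp add: r_def P_def c_def algebra_simps)
        then have "(norm (r k))\<^sup>2 = (norm (P k))\<^sup>2 + c\<^sup>2 * (norm w)\<^sup>2"
          using wP[of k]
          unfolding power2_norm_eq_inner
          by (simp add: inner_add_left inner_add_right inner_commute power2_eq_square)
        also have "c\<^sup>2 * (norm w)\<^sup>2 \<le> 1/4 * (2 * m'\<^sup>2)"
          using \<open>c\<^sup>2 \<le> 1/4\<close> w2 by (intro mult_mono) auto
        finally show ?thesis by simp
      qed
      \<comment> \<open>Modulo integers \<open>\<psi>\<close> factors through \<open>P\<close>: if
        \<open>P j = 0\<close>, then \<open>r j\<close> is shorter than \<open>m'\<close>, hence
        zero, so \<open>j\<close> is an integer multiple of \<open>w\<close>, where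
        \<open>\<psi>\<close> is integral.\<close>
      have \<psi>P: "\<psi> k - \<psi> l \<in> \<int>" if "k \<in> K" "l \<in> K" "P k = P l" for k l
      proof -
        define j where "j = k - l"
        have j: "j \<in> K" "P j = 0"
          using that Kdiff by (auto simp: j_def Pdiff)
        have "(norm (r j))\<^sup>2 \<le> m'\<^sup>2 / 2"
          using norm_r[of j] j by simp
        also have "\<dots> < m'\<^sup>2"
          using \<open>m' > 0\<close> by simp
        finally have "norm (r j) < m'"
          using \<open>m' > 0\<close> by (meson less_eq_real_def power2_less_imp_less)
        then have "r j = 0"
          using sep'[OF rK[OF j(1)]] by force
        then have "j = of_int (round ((w \<bullet> j) / (w \<bullet> w))) *\<^sub>R w"
          by (simp add: r_def)
        moreover have "of_int z *\<^sub>R w \<in> {k \<in> K. \<psi> k \<in> \<int>}" for z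
        proof (rule of_int_scaleR_in_subgroup)
          fix x y assume "x \<in> {k \<in> K. \<psi> k \<in> \<int>}" "y \<in> {k \<in> K. \<psi> k \<in> \<int>}"
          then have "x \<in> K" "y \<in> K" "(\<psi> (x - y) - \<psi> x + \<psi> y) + (\<psi> x - \<psi> y) \<in> \<int>"
            using \<psi> by (blast, blast, blast intro: Ints_add Ints_diff)
          then show "x - y \<in> {k \<in> K. \<psi> k \<in> \<int>}"
            using Kdiff by simp
        qed (use K0 \<psi>0 \<psi>w w in auto)
        ultimately have "\<psi> j \<in> \<int>"
          by (metis (no_types, lifting) mem_Collect_eq)
        then have "\<psi> j - (\<psi> (k - l) - \<psi> k + \<psi> l) \<in> \<int>"
          using \<psi>[OF that(1,2)] by (rule Ints_diff)
        then show ?thesis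
          by (simp add: j_def)
      qed
      \<comment> \<open>The factored character. The choice of lift affects its value only by an
        integer.\<close>
      define \<phi>1 where "\<phi>1 p = \<psi> (SOME k. k \<in> K \<and> P k = p)" for p
      have \<phi>1: "\<phi>1 (P k) - \<psi> k \<in> \<int>" if "k \<in> K" for k
        unfolding \<phi>1_def by (rule someI2[of _ k]) (use that \<psi>P in auto)
      define V1 where "V1 = {v \<in> V. w \<bullet> v = 0}"
      have "subspace V1"
        using V by (auto simp: V1_def subspace_def inner_add_right)
      have "{y \<in> V. \<forall>x\<in>span {w}. orthogonal x y} = V1"
        by (auto simp: V1_def orthogonal_def span_singleton)
      moreover have "dim {y \<in> V. \<forall>x\<in>span {w}. orthogonal x y} + dim (span {w}) = dim V"
        using V KV w by (intro dim_subspace_orthogonal_to_vectors span_minimal) auto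
      ultimately have "dim V1 = n"
        using Suc.prems(8) w by (simp add: dim_singleton)
      have "\<exists>y\<in>V1. norm y \<le> 2 ^ n / (m' / sqrt 2) \<and> (\<forall>k\<in>P ` K. y \<bullet> k - \<phi>1 k \<in> \<int>)"
      proof (rule Suc.IH)
        show "P ` K \<subseteq> V1"
          using V KV w wP by (auto simp: V1_def P_def intro!: subspace_diff subspace_scale)
        show "0 \<in> P ` K"
          using K0 by (auto simp: P_def image_iff intro!: bexI[of _ 0])
        show "m' / sqrt 2 > 0"
          using \<open>m' > 0\<close> by simp
        show "x - y \<in> P ` K" if xy: "x \<in> P ` K" "y \<in> P ` K" for x y
        proof -
          from xy obtain k l where "k \<in> K" "x = P k" "l \<in> K" "y = P l"
            by blast
          then show ?thesis
            using Pdiff[of k l] Kdiff[of k l] by (metis imageI)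
        qed
        show "\<phi>1 (x - y) - \<phi>1 x + \<phi>1 y \<in> \<int>" if xy: "x \<in> P ` K" "y \<in> P ` K" for x y
        proof -
          from xy obtain k l where kl: "k \<in> K" "x = P k" "l \<in> K" "y = P l"
            by blast
          have "(\<phi>1 (P (k - l)) - \<psi> (k - l)) - (\<phi>1 (P k) - \<psi> k) + (\<phi>1 (P l) - \<psi> l)
              + (\<psi> (k - l) - \<psi> k + \<psi> l) \<in> \<int>"
            using kl by (intro Ints_add Ints_diff \<phi>1 \<psi> Kdiff)
          then show ?thesis
            using kl by (simp add: Pdiff algebra_simps)
        qed
        show "m' / sqrt 2 \<le> norm p" if p: "p \<in> P ` K" "p \<noteq> 0" for p
        proof -
          from p obtain k where k: "k \<in> K" "p = P k" by blast
          have "P (r k) = P k"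
            using ww by (simp add: r_def P_def inner_diff_right algebra_simps diff_divide_distrib)
          with p k have "r k \<noteq> 0"
            by (auto simp: P_def)
          then have "m' \<le> norm (r k)"
            using sep' rK k by blast
          then have "m'\<^sup>2 \<le> (norm (r k))\<^sup>2"
            using \<open>m' > 0\<close> by (intro power_mono) auto
          then have "(m' / sqrt 2)\<^sup>2 \<le> (norm p)\<^sup>2"
            using norm_r[of k] k by (simp add: power_divide)
          then show ?thesis
            by (rule power2_le_imp_le) simp
        qed
      qed fact+
      then obtain y1 where y1: "y1 \<in> V1" "norm y1 \<le> 2 ^ n * sqrt 2 / m'"
          "\<And>k. k \<in> K \<Longrightarrow> y1 \<bullet> P k - \<phi>1 (P k) \<in> \<int>"
        by auto
      show ?thesis
      proof (intro bexI[of _ "y0 + y1"] conjI ballI)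
        show "y0 + y1 \<in> V"
          using y1 V KV w by (auto simp: y0_def V1_def intro!: subspace_add subspace_scale)
        fix k assume k: "k \<in> K"
        have "y1 \<bullet> P k = y1 \<bullet> k"
          using y1(1) by (simp add: V1_def P_def inner_diff_right inner_commute)
        then have "(y1 \<bullet> P k - \<phi>1 (P k)) + (\<phi>1 (P k) - \<psi> k) = (y0 + y1) \<bullet> k - \<phi> k"
          by (simp add: \<psi>_def inner_add_left)
        then show "(y0 + y1) \<bullet> k - \<phi> k \<in> \<int>"
          using y1(3)[OF k] \<phi>1[OF k] by (metis Ints_add)
      next
        have "norm y0 = \<bar>t\<bar> / norm w"
          using w by (simp add: y0_def dot_square_norm power2_eq_square)
        also have "\<dots> \<le> (1/2) / m'"
          using t sep'[OF w(1,2)] \<open>m' > 0\<close> by (intro frac_le) auto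
        finally have "norm (y0 + y1) \<le> (1/2 + 2 ^ n * sqrt 2) / m'"
          using norm_triangle_ineq[of y0 y1] y1(2) by (simp add: add_divide_distrib)
        \<comment> \<open>The induction closes because \<open>sqrt 2\<close> is at most
          \<open>3/2\<close> and \<open>1/2\<close> is at most half of \<open>2 ^ n\<close>.\<close>
        also have "\<dots> \<le> 2 ^ Suc n / m"
        proof (rule frac_le)
          have "sqrt 2 \<le> 3/2"
            by (rule real_le_lsqrt) (auto simp: power2_eq_square)
          then have "2 ^ n * sqrt 2 \<le> 2 ^ n * (3/2 :: real)"
            by (intro mult_left_mono) auto
          moreover have "(1::real) \<le> 2 ^ n" by simp
          ultimately show "1/2 + 2 ^ n * sqrt 2 \<le> 2 ^ Suc n"
            unfolding power_Suc by linarith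
        qed (use \<open>m > 0\<close> \<open>m \<le> m'\<close> in auto)
        finally show "norm (y0 + y1) \<le> 2 ^ Suc n / m" .
      qed
    qed
  }
qed

section \<open>Short bases of a lattice from the separation of its dual\<close>

lemma int_vec_diff: "int_vec u \<Longrightarrow> int_vec v \<Longrightarrow> int_vec (u - v)"
  by (simp add: int_vec_def)

lemma int_vec_axis: "int_vec (axis k 1)"
  by (simp add: int_vec_def axis_def)

text \<open>The columns of \<open>transpose A'\<close> span the dual of the lattice generated by the
  columns of \<open>A\<close>. If the lattice vectors of norm at most \<open>3 * \<rho>\<close> did
  not span, some unit \<open>z\<close> would be orthogonal to all of them. But
  \<open>2 * \<rho>\<close> times \<open>z\<close> lies within \<open>\<rho>\<close> of a lattice
  vector by the covering bound; that vector is short, and its inner product with \<open>z\<close> is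
  positive.\<close>

lemma short_integer_basis:
  fixes A A' :: "real^'n^'n"
  assumes AA': "A ** A' = mat 1" and "m > 0"
    and sep: "\<And>w. int_vec w \<Longrightarrow> w \<noteq> 0 \<Longrightarrow> m \<le> norm (transpose A' *v w)"
  obtains B where "B \<subseteq> Collect int_vec" "independent B" "card B = CARD('n)"
    "\<And>b. b \<in> B \<Longrightarrow> norm (A *v b) \<le> 3 * 2 ^ CARD('n) / m"
proof -
  define \<rho> where "\<rho> = 2 ^ CARD('n) / m"
  have "\<rho> > 0"
    using \<open>m > 0\<close> by (simp add: \<rho>_def)
  have A'A: "A' ** A = mat 1"
    using AA' by (simp add: matrix_left_right_inverse)
  define T where "T = transpose A'"
  have inner_T: "x \<bullet> (T *v w) = (A' *v x) \<bullet> w" for x w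
    unfolding T_def by (metis dot_lmul_matrix vector_transpose_matrix)
  have T0: "T *v w = 0 \<Longrightarrow> w = 0" for w
  proof -
    assume "T *v w = 0"
    moreover have "transpose A ** T = mat 1"
      by (simp add: T_def matrix_transpose_mul[symmetric] A'A)
    ultimately show "w = 0"
      by (metis matrix_vector_mul_assoc matrix_vector_mul_lid matrix_vector_mult_0_right)
  qed
  define X where "X = {b. int_vec b \<and> norm (A *v b) \<le> 3 * \<rho>}"
  have "span X = UNIV"
  proof (rule ccontr)
    assume "span X \<noteq> UNIV"
    then obtain a where a: "a \<noteq> 0" "\<And>x. x \<in> span X \<Longrightarrow> a \<bullet> x = 0"
      using span_not_UNIV_orthogonal by blast
    \<comment> \<open>\<open>T\<close> carries orthogonality to \<open>X\<close> over to
      orthogonality to the image of \<open>X\<close> under \<open>A\<close>, because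
      \<open>(A *v b) \<bullet> (T *v a) = b \<bullet> a\<close>.\<close>
    define z where "z = (1 / norm (T *v a)) *\<^sub>R (T *v a)"
    have z1: "norm z = 1"
      using a(1) T0 by (auto simp: z_def)
    have zX: "z \<bullet> (A *v b) = 0" if "b \<in> X" for b
    proof -
      have "(A *v b) \<bullet> (T *v a) = b \<bullet> a"
        unfolding inner_T by (simp add: matrix_vector_mul_assoc A'A)
      then show ?thesis
        using a(2)[OF span_base[OF that]] by (simp add: z_def inner_commute)
    qed
    define x0 where "x0 = (2 * \<rho>) *\<^sub>R z"
    have "\<exists>y\<in>UNIV. norm y \<le> 2 ^ CARD('n) / m \<and>
        (\<forall>k\<in>(*v) T ` Collect int_vec. y \<bullet> k - x0 \<bullet> k \<in> \<int>)"
    proof (rule bounded_coset_representative)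
      show "0 \<in> (*v) T ` Collect int_vec"
        by (auto simp: image_iff int_vec_def intro!: exI[of _ 0])
      show "x - y \<in> (*v) T ` Collect int_vec"
        if "x \<in> (*v) T ` Collect int_vec" "y \<in> (*v) T ` Collect int_vec" for x y
        using that by (auto simp: matrix_vector_mult_diff_distrib[symmetric] intro!: imageI int_vec_diff)
      show "m \<le> norm k" if "k \<in> (*v) T ` Collect int_vec" "k \<noteq> 0" for k
        using that sep unfolding T_def by (metis imageE mem_Collect_eq matrix_vector_mult_0_right)
    qed (use \<open>m > 0\<close> in \<open>auto simp: inner_diff_right dim_UNIV\<close>)
    then obtain y where y: "norm y \<le> \<rho>"
        "\<And>w. int_vec w \<Longrightarrow> y \<bullet> (T *v w) - x0 \<bullet> (T *v w) \<in> \<int>"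
      by (auto simp: \<rho>_def)
    define v where "v = x0 - y"
    \<comment> \<open>The coordinates of \<open>A' *v v\<close> are the pairings of \<open>v\<close>
      with the dual basis; they are integers since \<open>x0\<close> and \<open>y\<close> induce the
      same character. Hence \<open>v\<close> is a lattice vector.\<close>
    have "int_vec (A' *v v)"
      unfolding int_vec_def
    proof
      fix k
      have "- (y \<bullet> (T *v axis k 1) - x0 \<bullet> (T *v axis k 1)) \<in> \<int>"
        using y(2)[OF int_vec_axis] by (rule Ints_minus)
      then have "v \<bullet> (T *v axis k 1) \<in> \<int>"
        by (simp add: v_def inner_diff_left)
      then show "(A' *v v) $ k \<in> \<int>"
        unfolding inner_T by (simp add: inner_axis)
    qed
    moreover have Av: "A *v (A' *v v) = v"
      by (simp add: matrix_vector_mul_assoc AA')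
    moreover have "norm v \<le> 3 * \<rho>"
      using norm_triangle_ineq4[of x0 y] y(1) z1 \<open>\<rho> > 0\<close> by (simp add: v_def x0_def)
    ultimately have "A' *v v \<in> X"
      by (simp add: X_def)
    then have "z \<bullet> v = 0"
      using zX Av by metis
    moreover have "z \<bullet> v = 2 * \<rho> - z \<bullet> y"
      using z1 by (simp add: v_def x0_def inner_diff_right dot_square_norm)
    moreover have "z \<bullet> y \<le> \<rho>"
      using norm_cauchy_schwarz[of z y] y(1) z1 by simp
    ultimately show False
      using \<open>\<rho> > 0\<close> by linarith
  qed
  then have "dim X = CARD('n)"
    by (metis dim_span dim_UNIV DIM_cart DIM_real mult.right_neutral)
  then obtain B where "B \<subseteq> X" "independent B" "card B = CARD('n)"
    using basis_exists[of X] by metis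
  then show thesis
    by (intro that[of B]) (auto simp: X_def \<rho>_def)
qed

section \<open>The last successive minimum in terms of integer bases\<close>

lemma integer_basis_enumeration_sorted:
  fixes M :: "real^'n^'n"
  assumes "B \<subseteq> Collect int_vec" "independent B" "card B = i"
  obtains u :: "nat \<Rightarrow> real^'n" where "\<forall>j\<in>{1..i}. int_vec (u j)" "inj_on u {1..i}"
    "independent (u ` {1..i})" "\<forall>j\<in>{1..<i}. normM M (u j) \<le> normM M (u (Suc j))" "u ` {1..i} = B"
proof -
  have "finite B"
    using assms(2) by (rule independent_imp_finite)
  then obtain ys where ys: "set ys = B" "distinct ys"
    using finite_distinct_list by blast
  define xs where "xs = sort_key (normM M) ys"
  have xs: "set xs = B" "distinct xs" "sorted (map (normM M) xs)" "length xs = i"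
    using ys assms(3) distinct_card[OF ys(2)] by (auto simp: xs_def)
  \<comment> \<open>List positions start at 0, the tuples of \<open>succ_min\<close> at 1.\<close>
  define u where "u j = xs ! (j - 1)" for j
  have img: "u ` {1..i} = B"
  proof -
    have "(\<lambda>j. j - 1) ` {1..i} = {..<i}"
      by (force simp: image_iff intro!: bexI[of _ "Suc _"])
    then have "u ` {1..i} = (!) xs ` {..<i}"
      unfolding u_def by (metis image_image)
    also have "\<dots> = B"
      using xs by (auto simp: set_conv_nth)
    finally show ?thesis .
  qed
  show thesis
  proof (rule that[of u])
    show "inj_on u {1..i}"
      using img assms(3) by (intro eq_card_imp_inj_on) auto
    show "\<forall>j\<in>{1..<i}. normM M (u j) \<le> normM M (u (Suc j))"
    proof
      fix j assume "j \<in> {1..<i}"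
      then have "map (normM M) xs ! (j - 1) \<le> map (normM M) xs ! j"
        using xs by (intro sorted_nth_mono) auto
      then show "normM M (u j) \<le> normM M (u (Suc j))"
        using \<open>j \<in> {1..<i}\<close> xs by (simp add: u_def less_imp_diff_less)
    qed
  qed (use img assms in auto)
qed

text \<open>A basis can be sorted by \<open>normM M\<close>, and the last vector of a sorted tuple
  is the longest, so only the underlying set matters. The strict form avoids attainment of the
  infimum and later yields both upper bounds and measurability.\<close>

lemma succ_min_less_iff:
  fixes M :: "real^'n^'n"
  assumes "\<And>x. 0 \<le> x \<bullet> (M *v x)"
  shows "succ_min CARD('n) M < a \<longleftrightarrow> (\<exists>B. B \<subseteq> Collect int_vec \<and> independent B \<and>
    card B = CARD('n) \<and> (\<forall>b\<in>B. normM M b < a))"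
proof -
  define U where "U = {u :: nat \<Rightarrow> real^'n. (\<forall>j\<in>{1..CARD('n)}. int_vec (u j)) \<and>
    inj_on u {1..CARD('n)} \<and> independent (u ` {1..CARD('n)}) \<and>
    (\<forall>j\<in>{1..<CARD('n)}. normM M (u j) \<le> normM M (u (Suc j)))}"
  have eq: "succ_min CARD('n) M = Inf ((\<lambda>u. normM M (u CARD('n))) ` U)"
    unfolding succ_min_def U_def by (rule arg_cong[where f = Inf]) auto
  \<comment> \<open>\<open>Inf\<close> on the reals is a genuine infimum only for nonempty sets
    bounded below; the standard basis supplies nonemptiness.\<close>
  have bdd: "bdd_below ((\<lambda>u. normM M (u CARD('n))) ` U)"
    using assms by (intro bdd_belowI[of _ 0]) (auto simp: normM_def)
  have "\<exists>u. u \<in> U"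
  proof -
    have "Basis \<subseteq> (Collect int_vec :: (real^'n) set)"
      by (auto simp: Basis_vec_def int_vec_axis)
    then show ?thesis
      using integer_basis_enumeration_sorted[of Basis "CARD('n)" M] independent_Basis
      unfolding U_def mem_Collect_eq by (metis DIM_cart DIM_real mult.right_neutral)
  qed
  then have ne: "(\<lambda>u. normM M (u CARD('n))) ` U \<noteq> {}"
    by blast
  have "succ_min CARD('n) M < a \<longleftrightarrow> (\<exists>u\<in>U. normM M (u CARD('n)) < a)"
    unfolding eq using cInf_less_iff[OF ne bdd] by simp
  also have "\<dots> \<longleftrightarrow> (\<exists>B. B \<subseteq> Collect int_vec \<and> independent B \<and>
    card B = CARD('n) \<and> (\<forall>b\<in>B. normM M b < a))"
  proof
    assume "\<exists>u\<in>U. normM M (u CARD('n)) < a"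
    then obtain u where u: "u \<in> U" "normM M (u CARD('n)) < a" by blast
    have "normM M (u j) \<le> normM M (u CARD('n))" if "1 \<le> j" "j \<le> CARD('n)" for j
      using that(2,1)
    proof (induction rule: inc_induct)
      case (step k)
      then have "normM M (u k) \<le> normM M (u (Suc k))"
        using u(1) by (simp add: U_def)
      with step show ?case
        by simp
    qed simp
    then show "\<exists>B. B \<subseteq> Collect int_vec \<and> independent B \<and>
        card B = CARD('n) \<and> (\<forall>b\<in>B. normM M b < a)"
      using u by (intro exI[of _ "u ` {1..CARD('n)}"])
        (auto simp: U_def card_image intro!: le_less_trans[of "normM M (u _)" "normM M (u CARD('n))"])
  next
    assume "\<exists>B. B \<subseteq> Collect int_vec \<and> independent B \<and>
        card B = CARD('n) \<and> (\<forall>b\<in>B. normM M b < a)"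
    then obtain B where B: "B \<subseteq> Collect int_vec" "independent B" "card B = CARD('n)"
        "\<forall>b\<in>B. normM M b < a" by blast
    obtain u where "u \<in> U" "u ` {1..CARD('n)} = B"
      using integer_basis_enumeration_sorted[OF B(1-3), of M] unfolding U_def by blast
    moreover have "CARD('n) \<in> {1..CARD('n)}"
      by (simp add: Suc_leI)
    ultimately show "\<exists>u\<in>U. normM M (u CARD('n)) < a"
      using B(4) by blast
  qed
  finally show ?thesis .
qed

section \<open>Volume of ellipsoids\<close>

text \<open>
  The change-of-variables formula for linear maps in the library needs an index type of class
  \<open>wellorder\<close>; an arbitrary finite index type is replaced by a well-ordered copy.
\<close>

typedef 'a wellordered = "UNIV :: 'a set" by auto

instance wellordered :: (finite) finite
proof
  have "(UNIV :: 'a wellordered set) \<subseteq> range Abs_wellordered"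
  proof
    fix x :: "'a wellordered"
    show "x \<in> range Abs_wellordered"
      by (rule range_eqI[of _ _ "Rep_wellordered x"]) (rule Rep_wellordered_inverse[symmetric])
  qed
  then show "finite (UNIV :: 'a wellordered set)"
    by (rule finite_subset) (rule finite_imageI[OF finite])
qed

definition position :: "'a::finite wellordered \<Rightarrow> nat" where
  "position = to_nat"

lemma inj_position: "inj position"
  by (simp add: position_def)

instantiation wellordered :: (finite) wellorder
begin

definition less_eq_wellordered :: "'a wellordered \<Rightarrow> 'a wellordered \<Rightarrow> bool" where
  "x \<le> y \<longleftrightarrow> position x \<le> position y"

definition less_wellordered :: "'a wellordered \<Rightarrow> 'a wellordered \<Rightarrow> bool" where
  "x < y \<longleftrightarrow> position x < position y"

instance
proof
  fix P :: "'a wellordered \<Rightarrow> bool" and a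
  assume step: "\<And>x. (\<And>y. y < x \<Longrightarrow> P y) \<Longrightarrow> P x"
  show "P a"
  proof (induction a rule: measure_induct_rule[of position])
    case (less x)
    show ?case
      by (rule step) (simp add: less_wellordered_def less)
  qed
next
  fix x y :: "'a wellordered"
  assume "x \<le> y" "y \<le> x"
  then have "position x = position y"
    by (simp add: less_eq_wellordered_def)
  then show "x = y"
    by (rule injD[OF inj_position])
qed (unfold less_eq_wellordered_def less_wellordered_def, linarith+)

end

section \<open>Determinant and Lebesgue measure under reindexing of coordinates\<close>

lemma bij_Rep_wellordered: "bij Rep_wellordered"
proof (rule bijI)
  show "inj Rep_wellordered"
    by (simp add: inj_def Rep_wellordered_inject)
  show "surj Rep_wellordered"
    by (rule surjI[of _ Abs_wellordered]) (simp add: Abs_wellordered_inverse)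
qed

lemma CARD_wellordered: "CARD('a wellordered) = CARD('a)"
  using bij_betw_same_card[OF bij_Rep_wellordered] .

text \<open>Conjugation by \<open>f\<close> is a sign-preserving bijection between the permutations
  of the two index types, so the Leibniz sums agree term by term.\<close>

lemma det_reindex:
  fixes A :: "'a::comm_ring_1^'n^'n" and f :: "'m::finite \<Rightarrow> 'n"
  assumes "bij f"
  shows "det (\<chi> i j. A $ f i $ f j) = det A"
proof -
  have bij: "bij_betw f UNIV UNIV" and inj: "inj f"
    using assms by (auto simp: bij_def)
  have inv: "bij (inv f)"
    using assms by (rule bij_imp_bij_inv)
  have mp: "map_permutation UNIV f p = f \<circ> p \<circ> inv f" for p
    using assms by (auto simp: map_permutation_def restrict_id_def fun_eq_iff bij_is_surj)
  have "det A = (\<Sum>p | p permutes UNIV. of_int (sign (map_permutation UNIV f p)) *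
      (\<Prod>i\<in>UNIV. A $ i $ (map_permutation UNIV f p) i))"
    unfolding det_def
  proof (rule sum.reindex_bij_witness[of _ "\<lambda>q. inv f \<circ> q \<circ> f" "map_permutation UNIV f", symmetric])
    fix p :: "'m \<Rightarrow> 'm"
    show "inv f \<circ> map_permutation UNIV f p \<circ> f = p"
      using assms by (simp add: mp fun_eq_iff bij_is_inj)
    assume "p \<in> {p. p permutes UNIV}"
    then show "map_permutation UNIV f p \<in> {p. p permutes UNIV}"
      using map_permutation_permutes[OF bij] by simp
  next
    fix q :: "'n \<Rightarrow> 'n"
    show "map_permutation UNIV f (inv f \<circ> q \<circ> f) = q"
      using assms by (simp add: mp fun_eq_iff bij_is_surj surj_f_inv_f)
    assume "q \<in> {p. p permutes UNIV}"
    then show "inv f \<circ> q \<circ> f \<in> {p. p permutes UNIV}"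
      using bij_comp[OF bij_comp[OF assms permutes_bij] inv, of q]
      by (auto intro!: bij_imp_permutes simp: o_assoc)
  qed simp
  also have "\<dots> = det (\<chi> i j. A $ f i $ f j)"
    unfolding det_def
  proof (rule sum.cong[OF refl])
    fix p :: "'m \<Rightarrow> 'm" assume p: "p \<in> {p. p permutes UNIV}"
    have "sign (map_permutation UNIV f p) = sign p"
      using p inj by (intro sign_map_permutation) auto
    moreover have "(\<Prod>i\<in>UNIV. A $ i $ (map_permutation UNIV f p) i) = (\<Prod>i\<in>UNIV. A $ f i $ f (p i))"
      by (rule prod.reindex_bij_witness[of _ f "inv f"])
         (use assms in \<open>simp_all add: mp bij_is_inj bij_is_surj surj_f_inv_f\<close>)
    ultimately show "of_int (sign (map_permutation UNIV f p)) * (\<Prod>i\<in>UNIV. A $ i $ (map_permutation UNIV f p) i)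
       = of_int (sign p) * (\<Prod>i\<in>UNIV. (\<chi> i j. A $ f i $ f j) $ i $ p i)"
      by simp
  qed
  finally show ?thesis ..
qed

text \<open>Lebesgue measure is determined by its values on boxes, and the preimage of a box is the
  box with relabelled sides.\<close>

lemma distr_lborel_reindex:
  fixes f :: "'m::finite \<Rightarrow> 'n::finite"
  assumes "bij f"
  shows "distr lborel borel (\<lambda>x::real^'n. \<chi> i. x $ f i) = (lborel :: (real^'m) measure)"
proof (rule lborel_eqI[symmetric])
  let ?\<Phi> = "\<lambda>x::real^'n. (\<chi> i. x $ f i) :: real^'m"
  have meas[measurable]: "?\<Phi> \<in> borel_measurable borel"
    by (intro borel_measurable_continuous_onI continuous_intros)
  fix l u :: "real^'m"
  assume lu: "\<And>b. b \<in> Basis \<Longrightarrow> l \<bullet> b \<le> u \<bullet> b"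
  have le: "l $ i \<le> u $ i" for i
    using lu[of "axis i 1"] by (simp add: inner_axis)
  let ?l = "(\<chi> i. l $ inv f i) :: real^'n" and ?u = "(\<chi> i. u $ inv f i) :: real^'n"
  have "(\<forall>i. Q i (f i)) \<longleftrightarrow> (\<forall>j. Q (inv f j) j)" for Q
    using assms by (metis bij_inv_eq_iff)
  from this[of "\<lambda>i j. l $ i < _ $ j \<and> _ $ j < u $ i"] have "?\<Phi> -` box l u = box ?l ?u"
    by (auto simp: mem_box_cart)
  then have "emeasure (distr lborel borel ?\<Phi>) (box l u) = emeasure lborel (box ?l ?u)"
    by (subst emeasure_distr) auto
  also have "\<dots> = ennreal (\<Prod>b\<in>Basis. (?u - ?l) \<bullet> b)"
    by (rule emeasure_lborel_box) (use le in \<open>auto simp: Basis_vec_def inner_axis\<close>)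
  also have "(\<Prod>b\<in>Basis. (?u - ?l) \<bullet> b) = (\<Prod>i\<in>UNIV. (u - l) $ inv f i)"
    by (simp add: Basis_vec_def UNION_singleton_eq_range prod.reindex inj_on_def axis_eq_axis inner_axis)
  also have "\<dots> = (\<Prod>i\<in>UNIV. (u - l) $ i)"
    using prod.reindex_bij_betw[OF bij_imp_bij_inv[OF assms], of "\<lambda>i. (u - l) $ i"] by simp
  also have "\<dots> = (\<Prod>b\<in>Basis. (u - l) \<bullet> b)"
    by (simp add: Basis_vec_def UNION_singleton_eq_range prod.reindex inj_on_def axis_eq_axis inner_axis)
  finally show "emeasure (distr lborel borel ?\<Phi>) (box l u) = (\<Prod>b\<in>Basis. (u - l) \<bullet> b)" .
qed simp

lemma emeasure_ellipsoid_wellordered: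
  fixes B :: "real^'n::{finite,wellorder}^'n::{finite,wellorder}"
  assumes "det B \<noteq> 0" "r \<ge> 0"
  shows "emeasure lborel {x. norm (B *v x) < r} = ennreal (unit_ball_vol CARD('n) * r ^ CARD('n) / \<bar>det B\<bar>)"
proof -
  obtain B' where B': "B ** B' = mat 1" "B' ** B = mat 1"
    using assms(1) invertible_det_nz[of B] by (auto simp: invertible_def)
  have img: "{x. norm (B *v x) < r} = (*v) B' ` ball 0 r"
  proof (intro equalityI subsetI)
    fix x assume "x \<in> {x. norm (B *v x) < r}"
    then show "x \<in> (*v) B' ` ball 0 r"
      by (auto simp: image_iff matrix_vector_mul_assoc B' intro!: bexI[of _ "B *v x"])
  qed (auto simp: matrix_vector_mul_assoc B')
  have "det B' * det B = 1"
    using B'(2) by (metis det_I det_mul)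
  then have det: "\<bar>det B'\<bar> = 1 / \<bar>det B\<bar>"
    using assms(1) by (metis abs_divide abs_one nonzero_eq_divide_eq)
  have lin: "linear ((*v) B')" by simp
  have "(*v) B' ` ball 0 r \<in> lmeasurable"
    by (rule measurable_linear_image[OF lin]) simp
  then have "emeasure lebesgue ((*v) B' ` ball 0 r) = measure lebesgue ((*v) B' ` ball 0 r)"
    by (rule emeasure_eq_measure2)
  also have "measure lebesgue ((*v) B' ` ball 0 r) = \<bar>det B'\<bar> * measure lebesgue (ball (0::real^'n::_) r)"
    using measure_linear_image[OF lin, of "ball 0 r"] by simp
  also have "\<dots> = unit_ball_vol CARD('n) * r ^ CARD('n) / \<bar>det B\<bar>"
    using assms(2) by (simp add: det content_ball)
  moreover have "{x. norm (B *v x) < r} \<in> sets lborel"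
    by (simp add: open_Collect_less continuous_intros)
  ultimately show ?thesis
    by (simp add: img)
qed

text \<open>Relabelling coordinates preserves norms, Lebesgue measure and the determinant, which
  transfers the formula from the well-ordered copy.\<close>

lemma emeasure_ellipsoid:
  fixes B :: "real^'n^'n"
  assumes "det B \<noteq> 0" "r \<ge> 0"
  shows "emeasure lborel {x. norm (B *v x) < r} = ennreal (unit_ball_vol CARD('n) * r ^ CARD('n) / \<bar>det B\<bar>)"
proof -
  define f :: "'n wellordered \<Rightarrow> 'n" where "f = Rep_wellordered"
  have f: "bij f"
    unfolding f_def by (rule bij_Rep_wellordered)
  define B' where "B' = (\<chi> i j. B $ f i $ f j)"
  let ?\<Phi> = "\<lambda>x::real^'n. (\<chi> i. x $ f i) :: real^'n wellordered"
  have meas: "?\<Phi> \<in> borel_measurable borel"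
    by (intro borel_measurable_continuous_onI continuous_intros)
  have "B' *v ?\<Phi> x = ?\<Phi> (B *v x)" for x
    by (simp add: vec_eq_iff B'_def matrix_vector_mult_def
        sum.reindex_bij_betw[OF f, of "\<lambda>j. B $ f _ $ j * x $ j"])
  moreover have "norm (?\<Phi> x) = norm x" for x
    by (simp add: norm_vec_def L2_set_def sum.reindex_bij_betw[OF f, of "\<lambda>j. (norm (x $ j))\<^sup>2", simplified])
  ultimately have "?\<Phi> -` {x. norm (B' *v x) < r} = {x. norm (B *v x) < r}"
    by auto
  moreover have "{x. norm (B' *v x) < r} \<in> sets borel"
    by (simp add: open_Collect_less continuous_intros)
  ultimately have "emeasure lborel {x. norm (B *v x) < r} = emeasure (distr lborel borel ?\<Phi>) {x. norm (B' *v x) < r}"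
    using meas by (subst emeasure_distr) auto
  also have "\<dots> = emeasure lborel {x. norm (B' *v x) < r}"
    by (simp add: distr_lborel_reindex[OF f])
  also have "\<dots> = ennreal (unit_ball_vol CARD('n) * r ^ CARD('n) / \<bar>det B\<bar>)"
    using emeasure_ellipsoid_wellordered[of B' r] assms det_reindex[OF f, of B]
    by (simp add: B'_def CARD_wellordered)
  finally show ?thesis .
qed

section \<open>Haar measure on the orthogonal group\<close>

lemma continuous_on_matrix_mult [continuous_intros]:
  fixes f :: "'a::topological_space \<Rightarrow> real^'n^'m" and g :: "'a \<Rightarrow> real^'k^'n"
  assumes "continuous_on X f" "continuous_on X g"
  shows "continuous_on X (\<lambda>x. f x ** g x)"
  unfolding matrix_matrix_mult_def by (intro continuous_intros assms)

lemma continuous_on_matrix_vector_mult [continuous_intros]: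
  fixes f :: "'a::topological_space \<Rightarrow> real^'n^'m" and g :: "'a \<Rightarrow> real^'n"
  assumes "continuous_on X f" "continuous_on X g"
  shows "continuous_on X (\<lambda>x. f x *v g x)"
  unfolding matrix_vector_mult_def by (intro continuous_intros assms)

lemma continuous_on_matrix_transpose [continuous_intros]:
  fixes f :: "'a::topological_space \<Rightarrow> real^'n^'m"
  assumes "continuous_on X f"
  shows "continuous_on X (\<lambda>x. transpose (f x))"
  unfolding transpose_def by (intro continuous_intros assms)

lemma haar_prob_space: "haar_orthogonal \<mu> \<Longrightarrow> prob_space \<mu>"
  by (auto simp: haar_orthogonal_def intro: prob_spaceI)

lemma haar_sets: "haar_orthogonal \<mu> \<Longrightarrow> sets \<mu> = sets borel"
  by (simp add: haar_orthogonal_def)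

text \<open>Orthogonality is a closed condition, so the set is measurable and its full measure gives
  an almost-everywhere statement.\<close>

lemma haar_AE:
  fixes \<mu> :: "(real^'n^'n) measure"
  assumes "haar_orthogonal \<mu>"
  shows "AE R in \<mu>. orthogonal_matrix R"
proof -
  interpret prob_space \<mu>
    using assms by (rule haar_prob_space)
  have "closed {R :: real^'n^'n. transpose R ** R = mat 1}"
    by (intro closed_Collect_eq continuous_intros ) 
  then have "{R :: real^'n^'n. orthogonal_matrix R} \<in> sets \<mu>"
    by (simp add: haar_sets[OF assms] orthogonal_matrix)
  moreover have "emeasure \<mu> {R. orthogonal_matrix R} = 1"
    using assms by (simp add: haar_orthogonal_def)
  ultimately show ?thesis
    using AE_in_set_eq_1[of "{R. orthogonal_matrix R}"] by (simp add: emeasure_eq_measure)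
qed

lemma haar_left_invariant:
  fixes \<mu> :: "(real^'n^'n) measure"
  assumes \<mu>: "haar_orthogonal \<mu>" and Q: "orthogonal_matrix Q"
    and h: "h \<in> borel_measurable borel"
  shows "(\<integral>\<^sup>+R. h (Q ** R) \<partial>\<mu>) = (\<integral>\<^sup>+R. h R \<partial>\<mu>)"
proof -
  have [measurable_cong]: "sets \<mu> = sets borel"
    using \<mu> by (rule haar_sets)
  have [measurable]: "(\<lambda>R. Q ** R) \<in> borel_measurable borel"
    by (intro borel_measurable_continuous_onI continuous_intros)
  have "(\<integral>\<^sup>+R. h R \<partial>\<mu>) = (\<integral>\<^sup>+R. h R \<partial>distr \<mu> \<mu> (\<lambda>R. Q ** R))"
    using \<mu> Q by (simp add: haar_orthogonal_def)
  also have "\<dots> = (\<integral>\<^sup>+R. h (Q ** R) \<partial>\<mu>)"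
    using h by (intro nn_integral_distr) measurable
  finally show ?thesis ..
qed

text \<open>
  Only left invariance is assumed in the definition. Averaging \<open>h (P\<^sup>T R)\<close> over both \<open>P\<close> and \<open>R\<close>
  and applying left invariance in each variable shows invariance under transposition.
\<close>

lemma haar_transpose_invariant:
  fixes \<mu> :: "(real^'n^'n) measure"
  assumes \<mu>: "haar_orthogonal \<mu>" and h[measurable]: "h \<in> borel_measurable borel"
  shows "(\<integral>\<^sup>+R. h (transpose R) \<partial>\<mu>) = (\<integral>\<^sup>+R. h R \<partial>\<mu>)"
proof -
  interpret prob_space \<mu>
    using \<mu> by (rule haar_prob_space)
  interpret pair_sigma_finite \<mu> \<mu> ..
  have [measurable_cong]: "sets \<mu> = sets borel"
    using \<mu> by (rule haar_sets)
  have tr[measurable]: "transpose \<in> borel_measurable (borel :: (real^'n^'n) measure)"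
    by (intro borel_measurable_continuous_onI continuous_intros)
  have "(\<lambda>(P, R). transpose P ** R) \<in> borel_measurable (borel :: ((real^'n^'n) \<times> (real^'n^'n)) measure)"
    unfolding case_prod_unfold by (intro borel_measurable_continuous_onI continuous_intros)
  then have [measurable]: "(\<lambda>(P, R). transpose P ** R) \<in>
      borel_measurable (borel \<Otimes>\<^sub>M borel :: ((real^'n^'n) \<times> (real^'n^'n)) measure)"
    by (simp add: borel_prod)
  have "(\<integral>\<^sup>+R. h R \<partial>\<mu>) = (\<integral>\<^sup>+P. (\<integral>\<^sup>+R. h R \<partial>\<mu>) \<partial>\<mu>)"
    by (simp add: emeasure_space_1)
  also have "\<dots> = (\<integral>\<^sup>+P. (\<integral>\<^sup>+R. h (transpose P ** R) \<partial>\<mu>) \<partial>\<mu>)"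
  proof (rule nn_integral_cong_AE)
    show "AE P in \<mu>. (\<integral>\<^sup>+R. h R \<partial>\<mu>) = (\<integral>\<^sup>+R. h (transpose P ** R) \<partial>\<mu>)"
      using haar_AE[OF \<mu>] by eventually_elim (simp add: haar_left_invariant[OF \<mu> _ h])
  qed
  also have "\<dots> = (\<integral>\<^sup>+R. (\<integral>\<^sup>+P. h (transpose P ** R) \<partial>\<mu>) \<partial>\<mu>)"
    by (rule Fubini'[symmetric]) measurable
  also have "\<dots> = (\<integral>\<^sup>+R. (\<integral>\<^sup>+P. h (transpose P) \<partial>\<mu>) \<partial>\<mu>)"
  proof (rule nn_integral_cong_AE)
    show "AE R in \<mu>. (\<integral>\<^sup>+P. h (transpose P ** R) \<partial>\<mu>) = (\<integral>\<^sup>+P. h (transpose P) \<partial>\<mu>)"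
      using haar_AE[OF \<mu>]
    proof eventually_elim
      case (elim R)
      have "(\<integral>\<^sup>+P. h (transpose (transpose R ** P)) \<partial>\<mu>) = (\<integral>\<^sup>+P. h (transpose P) \<partial>\<mu>)"
        using elim by (intro haar_left_invariant[OF \<mu>]) auto
      then show ?case
        by (simp add: matrix_transpose_mul)
    qed
  qed
  also have "\<dots> = (\<integral>\<^sup>+P. h (transpose P) \<partial>\<mu>)"
    by (simp add: emeasure_space_1)
  finally show ?thesis ..
qed

text \<open>Transposition exchanges right and left multiplication. This side of the invariance is
  what lets the vector in \<open>R *v x\<close> be rotated under the average.\<close>

lemma haar_right_invariant:
  fixes \<mu> :: "(real^'n^'n) measure"
  assumes \<mu>: "haar_orthogonal \<mu>" and Q: "orthogonal_matrix Q"
    and h[measurable]: "h \<in> borel_measurable borel"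
  shows "(\<integral>\<^sup>+R. h (R ** Q) \<partial>\<mu>) = (\<integral>\<^sup>+R. h R \<partial>\<mu>)"
proof -
  have [measurable]: "transpose \<in> borel_measurable (borel :: (real^'n^'n) measure)"
    "(\<lambda>R. R ** Q) \<in> borel_measurable borel"
    by (intro borel_measurable_continuous_onI continuous_intros)+
  have "(\<integral>\<^sup>+R. h (R ** Q) \<partial>\<mu>) = (\<integral>\<^sup>+R. h (transpose R ** Q) \<partial>\<mu>)"
    by (rule haar_transpose_invariant[OF \<mu>, symmetric]) measurable
  also have "\<dots> = (\<integral>\<^sup>+R. h (transpose (transpose Q ** R)) \<partial>\<mu>)"
    by (simp add: matrix_transpose_mul)
  also have "\<dots> = (\<integral>\<^sup>+R. h (transpose R) \<partial>\<mu>)"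
    using Q by (intro haar_left_invariant[OF \<mu>]) auto
  also have "\<dots> = (\<integral>\<^sup>+R. h R \<partial>\<mu>)"
    by (rule haar_transpose_invariant[OF \<mu> h])
  finally show ?thesis .
qed

section \<open>Averaging the dual lattice sum\<close>

text \<open>Gram-Schmidt for the inner product of \<open>M\<close>: fewer than the full number of
  vectors \<open>M *v u i\<close> cannot span, so a nonzero \<open>v\<close> orthogonal to all of
  them exists and is then normalised.\<close>

lemma sym_pos_def_orthonormal:
  fixes M :: "real^'n^'n"
  assumes M: "sym_pos_def M" and "finite (X :: 'n set)"
  shows "\<exists>u :: 'n \<Rightarrow> real^'n. \<forall>i\<in>X. \<forall>j\<in>X. u i \<bullet> (M *v u j) = of_bool (i = j)"
  using \<open>finite X\<close>
proof (induction X)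
  case (insert k X)
  have sym: "x \<bullet> (M *v y) = y \<bullet> (M *v x)" for x y
    using M unfolding sym_pos_def_def
    by (metis dot_lmul_matrix inner_commute vector_transpose_matrix)
  from insert.IH obtain u :: "'n \<Rightarrow> real^'n"
    where u: "\<forall>i\<in>X. \<forall>j\<in>X. u i \<bullet> (M *v u j) = of_bool (i = j)"
    by blast
  let ?Y = "(\<lambda>i. M *v u i) ` X"
  have "dim ?Y \<le> card X"
    using insert.hyps by (meson card_image_le dim_le_card' finite_imageI order_trans)
  also have "card X < CARD('n)"
    using insert.hyps by (intro psubset_card_mono) auto
  finally have "span ?Y \<noteq> UNIV"
    by (metis dim_span dim_UNIV DIM_cart DIM_real mult.right_neutral less_irrefl)
  then obtain v where v: "v \<noteq> 0" "\<And>x. x \<in> span ?Y \<Longrightarrow> v \<bullet> x = 0"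
    using span_not_UNIV_orthogonal by blast
  define q where "q = v \<bullet> (M *v v)"
  have "q > 0"
    using M v(1) by (simp add: q_def sym_pos_def_def)
  define w where "w = (1 / sqrt q) *\<^sub>R v"
  have ww: "w \<bullet> (M *v w) = 1"
    using \<open>q > 0\<close> by (simp add: w_def q_def[symmetric] matrix_vector_mult_scaleR)
  have wu: "w \<bullet> (M *v u i) = 0" if "i \<in> X" for i
    using v(2)[OF span_base, of "M *v u i"] that by (simp add: w_def)
  then have uw: "u i \<bullet> (M *v w) = 0" if "i \<in> X" for i
    using that sym by metis
  have "\<forall>i\<in>insert k X. \<forall>j\<in>insert k X. (u(k := w)) i \<bullet> (M *v (u(k := w)) j) = of_bool (i = j)"
    using u ww wu uw insert.hyps by auto
  then show ?case by blast
qed simp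

text \<open>With an \<open>M\<close>-orthonormal basis as columns of \<open>F\<close>, the product
  of \<open>transpose F\<close>, \<open>M\<close> and \<open>F\<close> is the identity, so
  \<open>transpose F ** M\<close> inverts \<open>F\<close> and serves as \<open>S\<close>.\<close>

lemma sym_pos_def_factorization:
  fixes M :: "real^'n^'n"
  assumes "sym_pos_def M"
  obtains S F :: "real^'n^'n" where "M = transpose S ** S" "S ** F = mat 1" "F ** S = mat 1"
proof -
  obtain u :: "'n \<Rightarrow> real^'n" where u: "\<And>i j. u i \<bullet> (M *v u j) = of_bool (i = j)"
    using sym_pos_def_orthonormal[OF assms, of UNIV] by auto
  define F where "F = (\<chi> i j. u j $ i)"
  have Fcol: "F *v axis j 1 = u j" for j
    by (simp add: F_def matrix_vector_mul_component vec_eq_iff matrix_vector_mult_basis column_def)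
  have FMF: "transpose F ** (M ** F) = mat 1"
  proof -
    have "(transpose F ** (M ** F)) $ i $ j = mat 1 $ i $ j" for i j
    proof -
      have "A $ i $ j = axis i 1 \<bullet> (A *v axis j 1)" for A :: "real^'n^'n"
        by (simp add: matrix_vector_mult_basis column_def inner_axis')
      then have "(transpose F ** (M ** F)) $ i $ j = axis i 1 \<bullet> (transpose F *v (M *v (F *v axis j 1)))"
        by (simp only: matrix_vector_mul_assoc matrix_mul_assoc)
      also have "\<dots> = (F *v axis i 1) \<bullet> (M *v (F *v axis j 1))"
        by (metis dot_lmul_matrix vector_transpose_matrix transpose_transpose)
      finally show ?thesis
        by (simp add: Fcol u mat_def)
    qed
    then show ?thesis
      by (simp add: vec_eq_iff)
  qed
  define S where "S = transpose F ** M"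
  have SF: "S ** F = mat 1"
    using FMF by (simp add: S_def matrix_mul_assoc)
  then have FS: "F ** S = mat 1"
    by (simp add: matrix_left_right_inverse)
  have "transpose S ** transpose F = mat 1"
    by (metis FS matrix_transpose_mul transpose_mat)
  then have "M = transpose S ** S"
    by (simp add: S_def matrix_mul_assoc)
  then show thesis
    using SF FS by (rule that)
qed

section \<open>Lattice sums of radial functions and the dyadic kernel\<close>

lemma int_vec_norm_ge_1:
  assumes "int_vec w" "w \<noteq> 0"
  shows "1 \<le> norm w"
proof -
  obtain i where "w $ i \<noteq> 0"
    using assms(2) by (auto simp: vec_eq_iff)
  then have "1 \<le> \<bar>w $ i\<bar>"
    using assms(1) Ints_nonzero_abs_ge1 by (auto simp: int_vec_def)
  then show ?thesis
    using component_le_norm_cart[of w i] by linarith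
qed

lemma countable_int_vec: "countable (Collect int_vec :: (real^'n) set)"
proof (rule countable_subset)
  show "(Collect int_vec :: (real^'n) set) \<subseteq> (\<lambda>f. \<chi> i. f i) ` (UNIV \<rightarrow>\<^sub>E (\<int> :: real set))"
  proof
    fix w :: "real^'n" assume "w \<in> Collect int_vec"
    then show "w \<in> (\<lambda>f. \<chi> i. f i) ` (UNIV \<rightarrow>\<^sub>E (\<int> :: real set))"
      by (intro image_eqI[of _ _ "\<lambda>i. w $ i"]) (auto simp: int_vec_def vec_eq_iff)
  qed
  show "countable ((\<lambda>f. (\<chi> i. f i) :: real^'n) ` (UNIV \<rightarrow>\<^sub>E (\<int> :: real set)))"
    by (intro countable_image countable_PiE) (auto simp: Ints_def)
qed

text \<open>
  The balls of radius \<open>1/4\<close> obtained by moving each \<open>w\<close> towards the origin by \<open>1/4\<close> are disjoint,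
  and the values of \<open>G\<close> on them are at least \<open>G w\<close>.
\<close>

lemma lattice_sum_le_integral:
  fixes G :: "real^'n \<Rightarrow> ennreal"
  assumes G[measurable]: "G \<in> borel_measurable borel"
    and mono: "\<And>x y. norm x \<le> norm y \<Longrightarrow> G y \<le> G x"
  shows "(\<integral>\<^sup>+w. G w \<partial>count_space (Collect int_vec - {0})) \<le>
    ennreal (1 / measure lborel (ball (0 :: real^'n) (1/4))) * (\<integral>\<^sup>+x. G x \<partial>lborel)"
proof -
  define v where "v = measure lborel (ball (0 :: real^'n) (1/4))"
  have "v > 0"
    by (simp add: v_def)
  define W where "W = (Collect int_vec - {0} :: (real^'n) set)"
  define D where "D w = ball (w - (1 / (4 * norm w)) *\<^sub>R w) (1/4)" for w :: "real^'n"
  have W: "1 \<le> norm w" if "w \<in> W" for w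
    using that int_vec_norm_ge_1 by (auto simp: W_def)
  have D_dist: "dist w x < 1/2" if "w \<in> W" "x \<in> D w" for w x
  proof -
    have "dist w (w - (1 / (4 * norm w)) *\<^sub>R w) = 1/4"
      using W[OF that(1)] by (auto simp: dist_norm)
    then show ?thesis
      using that(2) dist_triangle[of w x "w - (1 / (4 * norm w)) *\<^sub>R w"] by (simp add: D_def)
  qed
  \<comment> \<open>As \<open>norm w\<close> is at least 1, the shift does not overshoot the origin:
    the centre has norm \<open>norm w - 1/4\<close>, and the radius adds at most
    \<open>1/4\<close>.\<close>
  have D_norm: "norm x \<le> norm w" if "w \<in> W" "x \<in> D w" for w x
  proof -
    have "0 \<le> 1 - 1 / (4 * norm w)"
      using W[OF that(1)] by (simp add: divide_le_eq)
    then have "norm ((1 - 1 / (4 * norm w)) *\<^sub>R w) = (1 - 1 / (4 * norm w)) * norm w"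
      by simp
    also have "\<dots> = norm w - 1/4"
      using W[OF that(1)] by (auto simp: left_diff_distrib)
    finally have "norm (w - (1 / (4 * norm w)) *\<^sub>R w) = norm w - 1/4"
      by (simp add: scaleR_left_diff_distrib)
    moreover have "norm (x - (w - (1 / (4 * norm w)) *\<^sub>R w)) < 1/4"
      using that(2) by (simp add: D_def dist_norm norm_minus_commute)
    ultimately show ?thesis
      using norm_triangle_sub[of x "w - (1 / (4 * norm w)) *\<^sub>R w"] by linarith
  qed
  \<comment> \<open>Each ball stays within \<open>1/2\<close> of its integer point, while distinct
    integer points are at distance at least 1.\<close>
  have disj: "w = w'" if "w \<in> W" "w' \<in> W" "x \<in> D w" "x \<in> D w'" for w w' x
  proof (rule ccontr)
    assume "w \<noteq> w'"
    then have "1 \<le> norm (w - w')"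
      using that by (intro int_vec_norm_ge_1) (auto simp: W_def int_vec_diff)
    moreover have "dist w w' < 1"
      using D_dist[OF that(1,3)] D_dist[OF that(2,4)] dist_triangle2[of w w' x] by linarith
    ultimately show False
      by (simp add: dist_norm)
  qed
  have G_le: "G w \<le> ennreal (1 / v) * (\<integral>\<^sup>+x. G x * indicator (D w) x \<partial>lborel)" if "w \<in> W" for w
  proof -
    have "emeasure lborel (D w) = ennreal v"
      by (simp add: D_def v_def content_ball emeasure_ball)
    then have "G w = ennreal (1 / v) * (\<integral>\<^sup>+x. G w * indicator (D w) x \<partial>lborel)"
      using \<open>v > 0\<close> by (simp add: D_def nn_integral_cmult_indicator mult.left_commute[of "ennreal _"] flip: ennreal_mult)
    also have "\<dots> \<le> ennreal (1 / v) * (\<integral>\<^sup>+x. G x * indicator (D w) x \<partial>lborel)"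
      using D_norm[OF that] mono
      by (intro mult_left_mono nn_integral_mono) (auto split: split_indicator)
    finally show ?thesis .
  qed
  have "(\<integral>\<^sup>+w. G w \<partial>count_space W) \<le>
      (\<integral>\<^sup>+w. ennreal (1 / v) * (\<integral>\<^sup>+x. G x * indicator (D w) x \<partial>lborel) \<partial>count_space W)"
    by (intro nn_integral_mono) (simp add: G_le)
  also have "\<dots> = ennreal (1 / v) * (\<integral>\<^sup>+w. (\<integral>\<^sup>+x. G x * indicator (D w) x \<partial>lborel) \<partial>count_space W)"
    by (rule nn_integral_cmult) simp
  also have "(\<integral>\<^sup>+w. (\<integral>\<^sup>+x. G x * indicator (D w) x \<partial>lborel) \<partial>count_space W) =
      (\<integral>\<^sup>+x. (\<integral>\<^sup>+w. G x * indicator (D w) x \<partial>count_space W) \<partial>lborel)"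
  proof (rule nn_integral_count_space_nn_integral[symmetric])
    show "countable W"
      using countable_int_vec unfolding W_def by (rule countable_Diff)
    show "(\<lambda>x. G x * indicator (D w) x) \<in> borel_measurable lborel" for w
    proof -
      have [measurable]: "D w \<in> sets borel"
        by (simp add: D_def)
      show ?thesis by measurable
    qed
  qed
  also have "\<dots> \<le> (\<integral>\<^sup>+x. G x \<partial>lborel)"
  proof (rule nn_integral_mono)
    fix x
    show "(\<integral>\<^sup>+w. G x * indicator (D w) x \<partial>count_space W) \<le> G x"
    proof (cases "\<exists>w\<in>W. x \<in> D w")
      case True
      then obtain w where w: "w \<in> W" "x \<in> D w" by blast
      have "(\<integral>\<^sup>+w. G x * indicator (D w) x \<partial>count_space W) =
          (\<Sum>w\<in>{w}. G x * indicator (D w) x)"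
        using w disj by (intro nn_integral_count_space') (auto split: split_indicator)
      then show ?thesis
        using w by simp
    next
      case False
      then have "(\<integral>\<^sup>+w. G x * indicator (D w) x \<partial>count_space W) = (\<integral>\<^sup>+w. 0 \<partial>count_space W)"
        by (intro nn_integral_cong) auto
      then show ?thesis by simp
    qed
  qed
  finally show ?thesis
    by (simp add: W_def v_def mult_left_mono)
qed

text \<open>
  A dyadic majorant of \<open>1 / norm z\<close> on the ball of radius \<open>a\<close>; it is infinite at the origin, where
  division would give \<open>0\<close>.
\<close>

definition dyadic_kernel :: "real \<Rightarrow> real^'n \<Rightarrow> ennreal" where
  "dyadic_kernel a z = (\<Sum>k. ennreal (2 ^ Suc k / a) * indicator {z. norm z < a / 2 ^ k} z)"

lemma borel_measurable_dyadic_kernel [measurable]: "dyadic_kernel a \<in> borel_measurable borel"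
proof -
  have [measurable]: "{z :: real^'n. norm z < a / 2 ^ k} \<in> sets borel" for k
    by (intro borel_open open_Collect_less continuous_intros)
  show ?thesis
    unfolding dyadic_kernel_def by measurable
qed

lemma dyadic_kernel_antimono:
  assumes "norm x \<le> norm y"
  shows "dyadic_kernel a y \<le> dyadic_kernel a x"
  unfolding dyadic_kernel_def using assms
  by (intro suminf_le mult_left_mono) (auto split: split_indicator)

text \<open>For \<open>0 < norm z < a\<close>, the vector lies in a shell between
  \<open>a / 2 ^ Suc k\<close> and \<open>a / 2 ^ k\<close>; the single term with index
  \<open>k\<close> is already at least \<open>1 / norm z\<close>. At the origin the left side is 0
  by the convention for division.\<close>

lemma inverse_norm_le_dyadic_kernel:
  assumes "a > 0"
  shows "ennreal (1 / norm z) \<le> ennreal (1 / a) + dyadic_kernel a z"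
proof (cases "z = 0 \<or> norm z \<ge> a")
  case True
  then have "1 / norm z \<le> 1 / a"
    using assms by (cases "z = 0") (auto intro: frac_le)
  then show ?thesis
    by (meson add_increasing2 ennreal_leI zero_le)
next
  case False
  then have z: "0 < norm z" "norm z < a" by auto
  have "eventually (\<lambda>k. a / 2 ^ k \<le> norm z) sequentially"
  proof -
    have "(\<lambda>k. a * (1/2) ^ k) \<longlonglongrightarrow> a * 0"
      by (intro tendsto_intros LIMSEQ_power_zero) auto
    then show ?thesis
      using order_tendstoD(2)[of "\<lambda>k. a / 2 ^ k" 0 sequentially "norm z"] z
      by (auto simp: power_one_over elim: eventually_mono)
  qed
  then obtain K where K: "a / 2 ^ K \<le> norm z"
    by (auto simp: eventually_sequentially)
  define j where "j = (LEAST k. a / 2 ^ k \<le> norm z)"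
  have j: "a / 2 ^ j \<le> norm z"
    unfolding j_def using K by (rule LeastI)
  then obtain k where k: "j = Suc k"
    using z by (cases j) auto
  have "norm z < a / 2 ^ k"
    using not_less_Least[of k "\<lambda>k. a / 2 ^ k \<le> norm z"] k unfolding j_def by auto
  then have "ennreal (1 / norm z) \<le> ennreal (2 ^ Suc k / a) * indicator {z. norm z < a / 2 ^ k} z"
    using j k z assms by (auto simp: field_simps intro!: ennreal_leI)
  also have "\<dots> \<le> dyadic_kernel a z"
  proof -
    define g where "g i = ennreal (2 ^ Suc i / a) * indicator {z. norm z < a / 2 ^ i} z" for i
    have "g k \<le> suminf g"
      using sum_le_suminf[of g "{k}"] by simp
    then show ?thesis
      unfolding g_def dyadic_kernel_def .
  qed
  finally show ?thesis
    by (simp add: add_increasing)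
qed

text \<open>With \<open>d = CARD('n)\<close> and \<open>V\<close> the unit ball volume, the
  ellipsoid of index \<open>k\<close> has volume \<open>V / 2 ^ (k * d)\<close>. Weighted by
  \<open>2 ^ Suc k / a\<close>, the terms are at most \<open>2 * V / a * (1/2) ^ k\<close> once
  \<open>d\<close> is at least 2, and the geometric series doubles the first term.\<close>

lemma nn_integral_dyadic_kernel:
  fixes B :: "real^'n^'n"
  assumes "a > 0" and B: "\<bar>det B\<bar> = a ^ CARD('n)" and "CARD('n) \<ge> 2"
  shows "(\<integral>\<^sup>+x. dyadic_kernel a (B *v x) \<partial>lborel) \<le> ennreal (4 * unit_ball_vol CARD('n) / a)"
proof -
  define V where "V = unit_ball_vol CARD('n)"
  have "V \<ge> 0"
    by (simp add: V_def)
  have "det B \<noteq> 0"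
    using B \<open>a > 0\<close> by auto
  have [measurable]: "{x. norm (B *v x) < a / 2 ^ k} \<in> sets borel" for k
    by (intro borel_open open_Collect_less continuous_intros)
  have "(\<integral>\<^sup>+x. dyadic_kernel a (B *v x) \<partial>lborel) =
      (\<integral>\<^sup>+x. (\<Sum>k. ennreal (2 ^ Suc k / a) * indicator {x. norm (B *v x) < a / 2 ^ k} x) \<partial>lborel)"
    by (simp add: dyadic_kernel_def indicator_def)
  also have "\<dots> = (\<Sum>k. \<integral>\<^sup>+x. ennreal (2 ^ Suc k / a) * indicator {x. norm (B *v x) < a / 2 ^ k} x \<partial>lborel)"
    by (intro nn_integral_suminf) measurable
  also have "\<dots> = (\<Sum>k. ennreal (2 ^ Suc k / a) * emeasure lborel {x. norm (B *v x) < a / 2 ^ k})"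
    by (intro suminf_cong nn_integral_cmult_indicator) measurable
  also have "\<dots> = (\<Sum>k. ennreal (2 ^ Suc k / a * (V * (a / 2 ^ k) ^ CARD('n) / \<bar>det B\<bar>)))"
  proof (rule suminf_cong)
    fix k
    show "ennreal (2 ^ Suc k / a) * emeasure lborel {x. norm (B *v x) < a / 2 ^ k} =
        ennreal (2 ^ Suc k / a * (V * (a / 2 ^ k) ^ CARD('n) / \<bar>det B\<bar>))"
      using \<open>a > 0\<close> \<open>V \<ge> 0\<close> emeasure_ellipsoid[OF \<open>det B \<noteq> 0\<close>, of "a / 2 ^ k"]
      by (subst ennreal_mult) (simp_all add: V_def)
  qed
  also have "\<dots> \<le> (\<Sum>k. ennreal (2 * V / a * (1/2) ^ k))"
  proof (intro suminf_le ennreal_leI)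
    fix k
    have "(2::real) ^ k * 2 ^ k = (2 ^ k) ^ 2"
      by (simp add: power2_eq_square)
    also have "\<dots> \<le> (2 ^ k) ^ CARD('n)"
      using assms(3) by (intro power_increasing) auto
    finally have "(2::real) ^ k / (2 ^ k) ^ CARD('n) \<le> (1/2) ^ k"
      by (simp add: field_simps power_one_over)
    then have "2 * V / a * (2 ^ k / (2 ^ k) ^ CARD('n)) \<le> 2 * V / a * (1/2) ^ k"
      using \<open>a > 0\<close> \<open>V \<ge> 0\<close> by (intro mult_left_mono) auto
    moreover have "2 ^ Suc k / a * (V * (a / 2 ^ k) ^ CARD('n) / \<bar>det B\<bar>) =
        2 * V / a * (2 ^ k / (2 ^ k) ^ CARD('n))"
      using \<open>a > 0\<close> by (simp add: B power_divide)
    ultimately show "2 ^ Suc k / a * (V * (a / 2 ^ k) ^ CARD('n) / \<bar>det B\<bar>) \<le> 2 * V / a * (1/2) ^ k"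
      by simp
  qed auto
  also have "\<dots> = ennreal (2 * V / a * 2)"
  proof (rule suminf_ennreal_eq)
    show "(\<lambda>k. 2 * V / a * (1/2) ^ k) sums (2 * V / a * 2)"
      using sums_mult[OF geometric_sums[of "1/2 :: real"], of "2 * V / a"] by simp
  qed (use \<open>a > 0\<close> \<open>V \<ge> 0\<close> in auto)
  finally show ?thesis
    by (simp add: V_def)
qed

section \<open>The last minimum of the rotated form: bounds and measurability\<close>

lemma inner_conj:
  fixes M R :: "real^'n^'n"
  shows "x \<bullet> ((transpose R ** M ** R) *v x) = (R *v x) \<bullet> (M *v (R *v x))"
proof -
  have "x \<bullet> (transpose R *v y) = (R *v x) \<bullet> y" for y
    by (metis dot_lmul_matrix vector_transpose_matrix)
  then show ?thesis
    by (simp only: matrix_vector_mul_assoc[symmetric])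
qed

lemma sym_pos_def_inner_nonneg: "sym_pos_def M \<Longrightarrow> 0 \<le> x \<bullet> (M *v x)"
  unfolding sym_pos_def_def by (cases "x = 0") (auto intro: less_imp_le)

lemma succ_min_conj_less_iff:
  fixes M R :: "real^'n^'n"
  assumes "sym_pos_def M"
  shows "succ_min CARD('n) (transpose R ** M ** R) < a \<longleftrightarrow>
    (\<exists>B. B \<subseteq> Collect int_vec \<and> independent B \<and> card B = CARD('n) \<and>
      (\<forall>b\<in>B. sqrt ((R *v b) \<bullet> (M *v (R *v b))) < a))"
  using succ_min_less_iff[of "transpose R ** M ** R" a] sym_pos_def_inner_nonneg[OF assms]
  by (simp only: inner_conj normM_def)

lemma succ_min_conj_le:
  fixes M R :: "real^'n^'n"
  assumes "sym_pos_def M" "B \<subseteq> Collect int_vec" "independent B" "card B = CARD('n)"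
    and "\<And>b. b \<in> B \<Longrightarrow> sqrt ((R *v b) \<bullet> (M *v (R *v b))) \<le> a"
  shows "succ_min CARD('n) (transpose R ** M ** R) \<le> a"
proof (rule dense_ge)
  fix c assume "a < c"
  then have "succ_min CARD('n) (transpose R ** M ** R) < c"
    unfolding succ_min_conj_less_iff[OF assms(1)] using assms(2-) by (meson le_less_trans)
  then show "succ_min CARD('n) (transpose R ** M ** R) \<le> c"
    by simp
qed

lemma succ_min_conj_nonneg:
  fixes M R :: "real^'n^'n"
  assumes "sym_pos_def M"
  shows "0 \<le> succ_min CARD('n) (transpose R ** M ** R)"
proof (rule ccontr)
  assume "\<not> 0 \<le> succ_min CARD('n) (transpose R ** M ** R)"
  then obtain B where B: "card B = CARD('n)" "\<forall>b\<in>B. sqrt ((R *v b) \<bullet> (M *v (R *v b))) < 0"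
    unfolding not_le succ_min_conj_less_iff[OF assms] by blast
  from B(1) obtain b where "b \<in> B"
    by fastforce
  then show False
    using B(2) sym_pos_def_inner_nonneg[OF assms, of "R *v b"] by force
qed

text \<open>Strict sublevel sets are unions, over integer bases, of finite intersections of open
  conditions on \<open>R\<close>, hence open.\<close>

lemma borel_measurable_succ_min_conj:
  fixes M :: "real^'n^'n"
  assumes "sym_pos_def M"
  shows "(\<lambda>R :: real^'n^'n. succ_min CARD('n) (transpose R ** M ** R)) \<in> borel_measurable borel"
proof (rule borel_measurable_iff_less[THEN iffD2], rule allI)
  fix a
  have "open (\<Union>B\<in>{B :: (real^'n) set. B \<subseteq> Collect int_vec \<and> independent B \<and> card B = CARD('n)}.
      \<Inter>b\<in>B. {R :: real^'n^'n. sqrt ((R *v b) \<bullet> (M *v (R *v b))) < a})"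
    by (intro open_UN ballI open_INT open_Collect_less continuous_intros)
       (auto dest: independent_imp_finite)
  also have "\<dots> = {R. succ_min CARD('n) (transpose R ** M ** R) < a}"
    by (auto simp: succ_min_conj_less_iff[OF assms])
  finally show "{R \<in> space (borel :: (real^'n^'n) measure). succ_min CARD('n) (transpose R ** M ** R) < a} \<in> sets borel"
    by (simp add: borel_open)
qed

text \<open>The lattice is generated by \<open>S ** R\<close>, and its dual by
  \<open>transpose F ** R\<close>. If the bracket has a finite value \<open>e\<close>, each nonzero
  dual vector has norm at least \<open>1 / e\<close>, because its own kernel term is bounded by the
  sum; transference then applies with separation \<open>1 / e\<close>.\<close>

lemma succ_min_conj_le_kernel_sum:
  fixes S F R :: "real^'n^'n"
  assumes "sym_pos_def M" and M: "M = transpose S ** S" and SF: "S ** F = mat 1"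
    and R: "orthogonal_matrix R" and "a > 0"
  shows "ennreal (succ_min CARD('n) (transpose R ** M ** R)) \<le> ennreal (3 * 2 ^ CARD('n)) *
    (ennreal (1 / a) + (\<integral>\<^sup>+w. dyadic_kernel a (transpose F *v (R *v w)) \<partial>count_space (Collect int_vec - {0})))"
proof -
  define E where "E = ennreal (1 / a) +
    (\<integral>\<^sup>+w. dyadic_kernel a (transpose F *v (R *v w)) \<partial>count_space (Collect int_vec - {0}))"
  define A' where "A' = transpose R ** F"
  have "R ** transpose R = mat 1"
    using R by (simp add: orthogonal_matrix_def)
  have AA': "(S ** R) ** A' = mat 1"
    by (metis A'_def SF \<open>R ** transpose R = mat 1\<close> matrix_mul_assoc matrix_mul_rid)
  then have tr: "transpose (S ** R) ** transpose A' = mat 1"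
    by (metis matrix_left_right_inverse matrix_transpose_mul transpose_mat)
  have TR: "transpose F *v (R *v w) = transpose A' *v w" for w
    by (simp add: A'_def matrix_transpose_mul matrix_vector_mul_assoc del: transpose_matrix_vector)
  have "ennreal (succ_min CARD('n) (transpose R ** M ** R)) \<le> ennreal (3 * 2 ^ CARD('n)) * E"
  proof (cases E)
    case (real e)
    have "ennreal (1 / a) \<le> E"
      by (simp add: E_def)
    then have "1 / a \<le> e"
      using real \<open>a > 0\<close> by (simp add: ennreal_le_iff)
    then have "e > 0"
      using \<open>a > 0\<close> by (meson less_le_trans zero_less_divide_1_iff)
    have "1 / e \<le> norm (transpose A' *v w)" if w: "int_vec w" "w \<noteq> 0" for w
    proof -
      have "transpose A' *v w \<noteq> 0"
        using w(2) tr by (metis matrix_vector_mul_assoc matrix_vector_mul_lid matrix_vector_mult_0_right)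
      have "ennreal (1 / norm (transpose A' *v w)) \<le> ennreal (1 / a) + dyadic_kernel a (transpose A' *v w)"
        using \<open>a > 0\<close> by (rule inverse_norm_le_dyadic_kernel)
      also have "dyadic_kernel a (transpose A' *v w) \<le>
          (\<integral>\<^sup>+w. dyadic_kernel a (transpose F *v (R *v w)) \<partial>count_space (Collect int_vec - {0}))"
        unfolding TR using w by (intro nn_integral_ge_point) auto
      then have "ennreal (1 / a) + dyadic_kernel a (transpose A' *v w) \<le> E"
        unfolding E_def by (rule add_left_mono)
      finally have "1 / norm (transpose A' *v w) \<le> e"
        using real by (simp add: ennreal_le_iff)
      then show ?thesis
        using \<open>e > 0\<close> \<open>transpose A' *v w \<noteq> 0\<close> by (simp add: field_simps)
    qed
    then obtain B where B: "B \<subseteq> Collect int_vec" "independent B" "card B = CARD('n)"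
        "\<And>b. b \<in> B \<Longrightarrow> norm ((S ** R) *v b) \<le> 3 * 2 ^ CARD('n) / (1 / e)"
      using short_integer_basis[OF AA', of "1 / e"] \<open>e > 0\<close> by (metis zero_less_divide_1_iff)
    have "succ_min CARD('n) (transpose R ** M ** R) \<le> 3 * 2 ^ CARD('n) * e"
    proof (rule succ_min_conj_le[OF assms(1) B(1-3)])
      fix b assume "b \<in> B"
      have "(R *v b) \<bullet> (M *v (R *v b)) = (S *v (R *v b)) \<bullet> (S *v (R *v b))"
        using inner_conj[of "R *v b" S "mat 1"] by (simp add: M)
      then have "sqrt ((R *v b) \<bullet> (M *v (R *v b))) = norm ((S ** R) *v b)"
        by (simp add: norm_eq_sqrt_inner matrix_vector_mul_assoc)
      then show "sqrt ((R *v b) \<bullet> (M *v (R *v b))) \<le> 3 * 2 ^ CARD('n) * e"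
        using B(4)[OF \<open>b \<in> B\<close>] by simp
    qed
    then show ?thesis
      using real by (simp add: ennreal_leI flip: ennreal_mult)
  next
    case top
    then show ?thesis
      by (simp add: ennreal_mult_top)
  qed
  then show ?thesis
    by (simp add: E_def)
qed

section \<open>Haar average of the kernel sum\<close>

text \<open>For fixed \<open>R\<close> the summand has ellipsoidal level sets. Averaging first makes
  it a radially decreasing function of \<open>w\<close>, to which the comparison of lattice sum and
  integral applies.\<close>

lemma haar_kernel_sum_le:
  fixes \<mu> :: "(real^'n^'n) measure" and T :: "real^'n^'n"
  assumes \<mu>: "haar_orthogonal \<mu>" and "a > 0" and T: "\<bar>det T\<bar> = a ^ CARD('n)" and d: "CARD('n) \<ge> 2"
  shows "(\<integral>\<^sup>+R. (\<integral>\<^sup>+w. dyadic_kernel a (T *v (R *v w)) \<partial>count_space (Collect int_vec - {0})) \<partial>\<mu>) \<le>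
    ennreal (4 * unit_ball_vol CARD('n) / measure lborel (ball (0 :: real^'n) (1/4)) / a)"
proof -
  interpret prob_space \<mu>
    using \<mu> by (rule haar_prob_space)
  interpret pair_sigma_finite lborel \<mu> ..
  have [measurable_cong]: "sets \<mu> = sets borel"
    using \<mu> by (rule haar_sets)
  have "(\<lambda>(x, R). T *v (R *v x)) \<in> borel_measurable (borel :: ((real^'n) \<times> (real^'n^'n)) measure)"
    unfolding case_prod_unfold by (intro borel_measurable_continuous_onI continuous_intros)
  then have [measurable]: "(\<lambda>(x, R). T *v (R *v x)) \<in>
      borel_measurable (borel \<Otimes>\<^sub>M borel :: ((real^'n) \<times> (real^'n^'n)) measure)"
    by (simp add: borel_prod)
  define G where "G x = (\<integral>\<^sup>+R. dyadic_kernel a (T *v (R *v x)) \<partial>\<mu>)" for x :: "real^'n"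
  have meas: "(\<lambda>R. dyadic_kernel a (T *v (R *v x))) \<in> borel_measurable borel" for x :: "real^'n"
  proof -
    have [measurable]: "(\<lambda>R :: real^'n^'n. T *v (R *v x)) \<in> borel_measurable borel"
      by (intro borel_measurable_continuous_onI continuous_intros)
    show ?thesis by measurable
  qed
  have G: "G \<in> borel_measurable borel"
    unfolding G_def by measurable
  \<comment> \<open>Shrinking \<open>y\<close> to the length of \<open>x\<close> increases the
    kernel pointwise, since \<open>T\<close> and \<open>R\<close> are linear; the rotation
    \<open>Q\<close> taking the shrunken vector to \<open>x\<close> is absorbed by right
    invariance.\<close>
  have G_mono: "G y \<le> G x" if "norm x \<le> norm y" for x y
  proof (cases "y = 0")
    case False
    define s where "s = norm x / norm y"
    have s: "0 \<le> s" "s \<le> 1"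
      using that False by (auto simp: s_def divide_le_eq)
    have "norm (s *\<^sub>R y) = norm x"
      using False s by (simp add: s_def)
    then obtain f where f: "orthogonal_transformation f" "f (s *\<^sub>R y) = x"
      using orthogonal_transformation_exists by blast
    define Q where "Q = matrix f"
    have Q: "orthogonal_matrix Q" "Q *v (s *\<^sub>R y) = x"
      using f by (auto simp: Q_def orthogonal_transformation_matrix matrix_works)
    have "G y \<le> (\<integral>\<^sup>+R. dyadic_kernel a (T *v (R *v (s *\<^sub>R y))) \<partial>\<mu>)"
      unfolding G_def
    proof (intro nn_integral_mono dyadic_kernel_antimono)
      fix R
      have "norm (T *v (R *v (s *\<^sub>R y))) = s * norm (T *v (R *v y))"
        using s by (simp add: matrix_vector_mult_scaleR)
      also have "\<dots> \<le> norm (T *v (R *v y))"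
        using s by (simp add: mult_left_le_one_le)
      finally show "norm (T *v (R *v (s *\<^sub>R y))) \<le> norm (T *v (R *v y))" .
    qed
    also have "\<dots> = (\<integral>\<^sup>+R. dyadic_kernel a (T *v ((R ** Q) *v (s *\<^sub>R y))) \<partial>\<mu>)"
      by (rule haar_right_invariant[OF \<mu> Q(1) meas, symmetric])
    also have "\<dots> = G x"
      by (simp add: G_def Q(2) flip: matrix_vector_mul_assoc)
    finally show ?thesis .
  qed (use that in auto)
  define v where "v = measure lborel (ball (0 :: real^'n) (1/4))"
  have "v > 0"
    by (simp add: v_def)
  have "(\<integral>\<^sup>+R. (\<integral>\<^sup>+w. dyadic_kernel a (T *v (R *v w)) \<partial>count_space (Collect int_vec - {0})) \<partial>\<mu>) =
      (\<integral>\<^sup>+w. G w \<partial>count_space (Collect int_vec - {0}))"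
    unfolding G_def
    by (intro nn_integral_count_space_nn_integral countable_Diff countable_int_vec)
       (use meas in measurable)
  also have "\<dots> \<le> ennreal (1 / v) * (\<integral>\<^sup>+x. G x \<partial>lborel)"
    unfolding v_def using G G_mono by (rule lattice_sum_le_integral)
  also have "(\<integral>\<^sup>+x. G x \<partial>lborel) = (\<integral>\<^sup>+R. (\<integral>\<^sup>+x. dyadic_kernel a (T *v (R *v x)) \<partial>lborel) \<partial>\<mu>)"
    unfolding G_def by (rule Fubini'[symmetric]) measurable
  \<comment> \<open>An orthogonal \<open>R\<close> leaves the absolute determinant of
    \<open>T ** R\<close> equal to that of \<open>T\<close>, so the inner bound is uniform in
    \<open>R\<close>.\<close>
  also have "\<dots> \<le> (\<integral>\<^sup>+R. ennreal (4 * unit_ball_vol CARD('n) / a) \<partial>\<mu>)"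
  proof (rule nn_integral_mono_AE)
    show "AE R in \<mu>. (\<integral>\<^sup>+x. dyadic_kernel a (T *v (R *v x)) \<partial>lborel) \<le> ennreal (4 * unit_ball_vol CARD('n) / a)"
      using haar_AE[OF \<mu>]
    proof eventually_elim
      case (elim R)
      then have "\<bar>det (T ** R)\<bar> = a ^ CARD('n)"
        using det_orthogonal_matrix[OF elim] T by (auto simp: det_mul)
      from nn_integral_dyadic_kernel[OF \<open>a > 0\<close> this d] show ?case
        by (simp add: matrix_vector_mul_assoc)
    qed
  qed
  also have "\<dots> = ennreal (4 * unit_ball_vol CARD('n) / a)"
    by (simp add: emeasure_space_1)
  finally have "(\<integral>\<^sup>+R. (\<integral>\<^sup>+w. dyadic_kernel a (T *v (R *v w)) \<partial>count_space (Collect int_vec - {0})) \<partial>\<mu>) \<le>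
      ennreal (1 / v) * ennreal (4 * unit_ball_vol CARD('n) / a)"
    by (simp add: mult_left_mono)
  also have "\<dots> = ennreal (4 * unit_ball_vol CARD('n) / v / a)"
    using \<open>v > 0\<close> \<open>a > 0\<close> by (simp flip: ennreal_mult)
  finally show ?thesis
    by (simp add: v_def)
qed

section \<open>The integral of the last minimum\<close>

text \<open>Integrability accompanies the bound because the Bochner integral of a non-integrable
  function is 0 by convention, which would make the bound empty.\<close>

lemma integrable_and_integral_le:
  fixes f :: "'a \<Rightarrow> real"
  assumes "f \<in> borel_measurable N" "\<And>x. 0 \<le> f x" "(\<integral>\<^sup>+x. ennreal (f x) \<partial>N) \<le> ennreal c" "0 \<le> c"
  shows "integrable N f \<and> (\<integral>x. f x \<partial>N) \<le> c"
proof -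
  have int: "integrable N f"
    using assms by (intro integrableI_nonneg) (auto intro: le_less_trans)
  then have "ennreal (\<integral>x. f x \<partial>N) \<le> ennreal c"
    using assms by (simp add: nn_integral_eq_integral)
  then show ?thesis
    using int assms(4) by (simp add: ennreal_le_iff)
qed

lemma borel_measurable_nn_integral_count_space:
  fixes f :: "'a \<Rightarrow> 'i \<Rightarrow> ennreal"
  assumes "countable I" "\<And>i. i \<in> I \<Longrightarrow> (\<lambda>x. f x i) \<in> borel_measurable N"
  shows "(\<lambda>x. \<integral>\<^sup>+i. f x i \<partial>count_space I) \<in> borel_measurable N"
proof -
  interpret sigma_finite_measure "count_space I"
    using assms(1) by (rule sigma_finite_measure_count_space_countable)
  have "(\<lambda>(i, x). f x i) \<in> borel_measurable (count_space I \<Otimes>\<^sub>M N)"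
    using assms by (intro measurable_pair_measure_countable1) auto
  from measurable_pair_swap[OF this] show ?thesis
    by (intro borel_measurable_nn_integral) simp
qed

lemma nn_integral_succ_min_le:
  fixes \<mu> :: "(real^'n^'n) measure" and M :: "real^'n^'n"
  assumes \<mu>: "haar_orthogonal \<mu>" and M: "sym_pos_def M" and d: "CARD('n) \<ge> 2"
  shows "(\<integral>\<^sup>+R. ennreal (succ_min CARD('n) (transpose R ** M ** R)) \<partial>\<mu>) \<le>
    ennreal (3 * 2 ^ CARD('n) * (1 + 4 * unit_ball_vol CARD('n) / measure lborel (ball (0 :: real^'n) (1/4)))
      * det M powr (1 / (2 * real CARD('n))))"
proof -
  interpret prob_space \<mu>
    using \<mu> by (rule haar_prob_space)
  have [measurable_cong]: "sets \<mu> = sets borel"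
    using \<mu> by (rule haar_sets)
  obtain S F :: "real^'n^'n" where SF: "M = transpose S ** S" "S ** F = mat 1"
    using sym_pos_def_factorization[OF M] .
  have "det S * det F = 1"
    using SF(2) by (metis det_I det_mul)
  then have "det F \<noteq> 0" by auto
  \<comment> \<open>This scale makes \<open>a ^ CARD('n)\<close> equal the absolute determinant of
    \<open>F\<close>, so the cutoff term and the averaged sum are both of order
    \<open>1 / a\<close>. As \<open>det M\<close> is the inverse square of \<open>det F\<close>,
    \<open>1 / a\<close> is exactly the power of \<open>det M\<close> in the claim.\<close>
  define a where "a = \<bar>det F\<bar> powr (1 / real CARD('n))"
  have "a > 0"
    using \<open>det F \<noteq> 0\<close> by (simp add: a_def)
  have ad: "a ^ CARD('n) = \<bar>det F\<bar>"
    using \<open>det F \<noteq> 0\<close> by (simp add: a_def flip: powr_realpow powr_powr) (simp add: powr_powr)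
  have "det S = 1 / det F"
    using \<open>det S * det F = 1\<close> \<open>det F \<noteq> 0\<close> by (simp add: field_simps)
  then have "det M = inverse \<bar>det F\<bar> ^ 2"
    by (simp add: SF(1) det_mul power2_eq_square field_simps)
  then have "det M powr (1 / (2 * real CARD('n))) = (inverse \<bar>det F\<bar> powr 2) powr (1 / (2 * real CARD('n)))"
    using \<open>det F \<noteq> 0\<close> by (simp add: powr_realpow)
  also have "\<dots> = inverse \<bar>det F\<bar> powr (1 / real CARD('n))"
    unfolding powr_powr by simp
  also have "\<dots> = 1 / a"
    unfolding a_def inverse_powr by (rule inverse_eq_divide)
  finally have det: "det M powr (1 / (2 * real CARD('n))) = 1 / a" .
  define c where "c = (3 * 2 ^ CARD('n) :: real)"
  define b where "b = 4 * unit_ball_vol CARD('n) / measure lborel (ball (0 :: real^'n) (1/4))"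
  have "c \<ge> 0" "b \<ge> 0"
    by (auto simp: c_def b_def)
  define \<Sigma> where "\<Sigma> R = (\<integral>\<^sup>+w. dyadic_kernel a (transpose F *v (R *v w)) \<partial>count_space (Collect int_vec - {0}))" for R :: "real^'n^'n"
  have [measurable]: "\<Sigma> \<in> borel_measurable borel"
    unfolding \<Sigma>_def
  proof (rule borel_measurable_nn_integral_count_space)
    fix w :: "real^'n"
    have [measurable]: "(\<lambda>R :: real^'n^'n. transpose F *v (R *v w)) \<in> borel_measurable borel"
      by (intro borel_measurable_continuous_onI continuous_intros)
    show "(\<lambda>R. dyadic_kernel a (transpose F *v (R *v w))) \<in> borel_measurable borel"
      by measurable
  qed (intro countable_Diff countable_int_vec)
  have "(\<integral>\<^sup>+R. ennreal (succ_min CARD('n) (transpose R ** M ** R)) \<partial>\<mu>) \<le>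
      (\<integral>\<^sup>+R. ennreal c * (ennreal (1 / a) + \<Sigma> R) \<partial>\<mu>)"
  proof (rule nn_integral_mono_AE)
    show "AE R in \<mu>. ennreal (succ_min CARD('n) (transpose R ** M ** R)) \<le> ennreal c * (ennreal (1 / a) + \<Sigma> R)"
      using haar_AE[OF \<mu>] unfolding c_def \<Sigma>_def
      by eventually_elim (rule succ_min_conj_le_kernel_sum[OF M SF _ \<open>a > 0\<close>])
  qed
  also have "\<dots> = ennreal c * ((\<integral>\<^sup>+R. ennreal (1 / a) \<partial>\<mu>) + (\<integral>\<^sup>+R. \<Sigma> R \<partial>\<mu>))"
    by (simp add: nn_integral_cmult nn_integral_add)
  also have "\<dots> \<le> ennreal c * (ennreal (1 / a) + ennreal (b / a))"
    using haar_kernel_sum_le[OF \<mu> \<open>a > 0\<close> _ d, of "transpose F"] ad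
    by (intro mult_left_mono add_mono) (auto simp: emeasure_space_1 b_def \<Sigma>_def)
  also have "\<dots> = ennreal (c * (1 + b) * (1 / a))"
    using \<open>a > 0\<close> \<open>c \<ge> 0\<close> \<open>b \<ge> 0\<close> by (simp add: algebra_simps add_divide_distrib flip: ennreal_mult ennreal_plus)
  finally show ?thesis
    by (simp add: c_def b_def det)
qed

lemma succ_min_conj_le_dimension_one:
  fixes M R :: "real^'n^'n"
  assumes M: "sym_pos_def M" and d: "CARD('n) = 1" and R: "orthogonal_matrix R"
  shows "succ_min CARD('n) (transpose R ** M ** R) \<le> det M powr (1 / (2 * real CARD('n)))"
proof -
  obtain k :: 'n where k: "UNIV = {k}"
    using d card_1_singletonE by blast
  then have all_k: "i = k" for i by blast
  have "(R $ k $ k)\<^sup>2 = (transpose R ** R) $ k $ k"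
    by (simp add: matrix_matrix_mult_def transpose_def k power2_eq_square)
  also have "\<dots> = 1"
    using R by (simp add: orthogonal_matrix_def mat_def)
  finally have Rk: "(R $ k $ k)\<^sup>2 = 1" .
  have det: "det M = M $ k $ k"
    using det_diagonal[of M] all_k by (simp add: k) metis
  have "M $ k $ k > 0"
  proof -
    have "axis k 1 \<bullet> (M *v axis k 1) > 0"
      using M by (simp add: sym_pos_def_def axis_eq_0_iff)
    then show ?thesis
      by (simp add: matrix_vector_mult_basis column_def inner_axis')
  qed
  have "succ_min CARD('n) (transpose R ** M ** R) \<le> sqrt (M $ k $ k)"
  proof (rule succ_min_conj_le[OF M])
    show "{axis k 1} \<subseteq> Collect int_vec"
      by (simp add: int_vec_axis)
    show "independent {axis k (1 :: real)}"
      by (simp add: axis_eq_0_iff)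
    show "sqrt ((R *v b) \<bullet> (M *v (R *v b))) \<le> sqrt (M $ k $ k)" if "b \<in> {axis k 1}" for b
      using that Rk
      by (simp add: inner_vec_def matrix_vector_mult_def k axis_def power2_eq_square mult.left_commute[of "R $ k $ k"])
  qed (use d in simp)
  then show ?thesis
    using \<open>M $ k $ k > 0\<close> by (simp add: d det powr_half_sqrt)
qed

theorem theorem2:
  "\<exists>C::real. \<forall>(\<mu>::(real^'n^'n) measure) (M::real^'n^'n).
     haar_orthogonal \<mu> \<longrightarrow> sym_pos_def M \<longrightarrow>
       integrable \<mu> (\<lambda>R. succ_min CARD('n) (transpose R ** M ** R)) \<and>
       (\<integral>R. succ_min CARD('n) (transpose R ** M ** R) \<partial>\<mu>)
         \<le> C * det M powr (1 / (2 * real CARD('n)))"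
proof -
  \<comment> \<open>The estimate is first obtained for the nonnegative integral with one constant
    for all \<open>\<mu>\<close> and \<open>M\<close>; nonnegativity of \<open>C\<close> makes the
    finite bound transferable to the real integral.\<close>
  have "\<exists>C\<ge>0. \<forall>(\<mu>::(real^'n^'n) measure) (M::real^'n^'n). haar_orthogonal \<mu> \<longrightarrow> sym_pos_def M \<longrightarrow>
    (\<integral>\<^sup>+R. ennreal (succ_min CARD('n) (transpose R ** M ** R)) \<partial>\<mu>)
      \<le> ennreal (C * det M powr (1 / (2 * real CARD('n))))"
  proof (cases "CARD('n) = 1")
    case True
    show ?thesis
    proof (intro exI[of _ 1] conjI allI impI)
      fix \<mu> :: "(real^'n^'n) measure" and M :: "real^'n^'n"
      assume \<mu>: "haar_orthogonal \<mu>" and M: "sym_pos_def M"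
      interpret prob_space \<mu>
        using \<mu> by (rule haar_prob_space)
      have "(\<integral>\<^sup>+R. ennreal (succ_min CARD('n) (transpose R ** M ** R)) \<partial>\<mu>) \<le>
          (\<integral>\<^sup>+R. ennreal (det M powr (1 / (2 * real CARD('n)))) \<partial>\<mu>)"
        using haar_AE[OF \<mu>] succ_min_conj_le_dimension_one[OF M True]
        by (intro nn_integral_mono_AE) (auto elim!: eventually_mono intro: ennreal_leI)
      then show "(\<integral>\<^sup>+R. ennreal (succ_min CARD('n) (transpose R ** M ** R)) \<partial>\<mu>)
          \<le> ennreal (1 * det M powr (1 / (2 * real CARD('n))))"
        by (simp add: emeasure_space_1)
    qed simp
  next
    case False
    then have "CARD('n) \<ge> 2"
      using zero_less_card_finite[where 'a = 'n] by linarith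
    then show ?thesis
      by (intro exI[of _ "3 * 2 ^ CARD('n) *
          (1 + 4 * unit_ball_vol CARD('n) / measure lborel (ball (0 :: real^'n) (1/4)))"]
        conjI allI impI nn_integral_succ_min_le) auto
  qed
  then obtain C where C: "C \<ge> 0" "\<And>(\<mu>::(real^'n^'n) measure) (M::real^'n^'n).
      haar_orthogonal \<mu> \<Longrightarrow> sym_pos_def M \<Longrightarrow>
      (\<integral>\<^sup>+R. ennreal (succ_min CARD('n) (transpose R ** M ** R)) \<partial>\<mu>)
        \<le> ennreal (C * det M powr (1 / (2 * real CARD('n))))"
    by blast
  show ?thesis
  proof (intro exI[of _ C] allI impI integrable_and_integral_le)
    fix \<mu> :: "(real^'n^'n) measure" and M :: "real^'n^'n"
    assume \<mu>: "haar_orthogonal \<mu>" and M: "sym_pos_def M"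
    show "(\<lambda>R. succ_min CARD('n) (transpose R ** M ** R)) \<in> borel_measurable \<mu>"
      using borel_measurable_succ_min_conj[OF M] haar_sets[OF \<mu>] by (simp cong: measurable_cong_sets)
  qed (use C succ_min_conj_nonneg in auto)
qed

end
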